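(* There exist absolute constants $C_0,C_1,C_2>0$ such that the following holds. Let $d_1,d_2$ be positive integers, $\alpha\ge1$ and $r\ge1$ be such that $\alpha^2r\max\{d_1,d_2\}\ge C_0$, and let $\sigma>0$. Let $$K=\left\{M\in\mathbb{R}^{d_1\times d_2}:\ \|M\|_*\le\alpha\sqrt{rd_1d_2},\ \|M\|_\infty\le\alpha\right\}.$$ Let $\Omega$ be any subset of $[d_1]\times[d_2]$ with cardinality $n$, and let $Z$ be a $d_1\times d_2$ random matrix with i.i.d. mean-zero Gaussian entries with variance $\sigma^2$. Consider any algorithm which, for any $M\in K$, takes as input $Y_{i,j}=M_{i,j}+Z_{i,j}$ for $(i,j)\in\Omega$ and returns $\widehat{M}$. Then there exists $M\in K$ such that with probability at least $3/4$, $$\frac{1}{d_1d_2}\|M-\widehat{M}\|_F^2\ge\min\left\{C_1,\ C_2\,\alpha\sigma\sqrt{\frac{r\max\{d_1,d_2\}}{n}}\right\},$$ as long as the right-hand side of this inequality exceeds $r\alpha^2/\min(d_1,d_2)$.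
   Context: Notation: $[d]=\{1,\dots,d\}$; $\|\cdot\|_*$ is the nuclear norm (sum of singular values), $\|\cdot\|_F$ the Frobenius norm, $\|X\|_\infty=\max_{i,j}|X_{i,j}|$. *)

theory Defs
  imports
    "HOL-Probability.Probability"
    "Jordan_Normal_Form.Char_Poly"
begin

text \<open>
  Matrices are those of the Jordan normal form library, so that the dimensions are ordinary
  natural numbers; rows and columns are indexed from 0, i.e. the index set
  \<open>[d\<^sub>1] \<times> [d\<^sub>2]\<close> is \<open>{..<d1} \<times> {..<d2}\<close>.
\<close>

text \<open>
  The singular values are the square roots of the eigenvalues of \<open>A\<^sup>T A\<close>, with multiplicity.
  That matrix is symmetric and positive semidefinite, so all complex roots of its characteristic
  polynomial are real and nonnegative and \<^const>\<open>proots\<close> over the reals misses none.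
  For a matrix with more columns than rows the multiset is padded with zeros.
\<close>

definition singular_values :: "real mat \<Rightarrow> real multiset" where
  "singular_values A = image_mset sqrt (proots (char_poly (transpose_mat A * A)))"

definition nuclear_norm :: "real mat \<Rightarrow> real" where
  "nuclear_norm A = sum_mset (singular_values A)"

definition frobenius_norm :: "real mat \<Rightarrow> real" where
  "frobenius_norm A = sqrt (\<Sum>i<dim_row A. \<Sum>j<dim_col A. (A $$ (i, j))\<^sup>2)"

text \<open>Only meaningful when both dimensions are positive.\<close>

definition max_norm :: "real mat \<Rightarrow> real" where
  "max_norm A = Max {\<bar>A $$ (i, j)\<bar> | i j. i < dim_row A \<and> j < dim_col A}"

definition K_set :: "nat \<Rightarrow> nat \<Rightarrow> real \<Rightarrow> real \<Rightarrow> real mat set" where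
  "K_set d1 d2 \<alpha> r =
     {M \<in> carrier_mat d1 d2.
        nuclear_norm M \<le> \<alpha> * sqrt (r * real d1 * real d2) \<and> max_norm M \<le> \<alpha>}"

text \<open>The law of a \<open>d1 \<times> d2\<close> matrix with i.i.d. \<open>N(0, \<sigma>\<^sup>2)\<close> entries.\<close>

definition gaussian_noise :: "nat \<Rightarrow> nat \<Rightarrow> real \<Rightarrow> (nat \<times> nat \<Rightarrow> real) measure" where
  "gaussian_noise d1 d2 \<sigma> =
     (\<Pi>\<^sub>M ij \<in> {..<d1} \<times> {..<d2}. density lborel (\<lambda>x. ennreal (normal_density 0 \<sigma> x)))"

definition observe ::
    "(nat \<times> nat) set \<Rightarrow> real mat \<Rightarrow> (nat \<times> nat \<Rightarrow> real) \<Rightarrow> (nat \<times> nat \<Rightarrow> real)" where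
  "observe \<Omega> M Z = (\<lambda>ij \<in> \<Omega>. M $$ ij + Z ij)"

text \<open>
  An algorithm maps the observed entries, and possibly a random seed with law \<open>S\<close>, to a
  \<open>d1 \<times> d2\<close> matrix. Deterministic algorithms are those that ignore the seed. The seed is
  real-valued (with an arbitrary law) so that no type variable occurs in the theorem: otherwise
  its constants could depend on that type.
\<close>

definition matrix_algorithm ::
    "nat \<Rightarrow> nat \<Rightarrow> (nat \<times> nat) set \<Rightarrow> real measure
      \<Rightarrow> ((nat \<times> nat \<Rightarrow> real) \<Rightarrow> real \<Rightarrow> real mat) \<Rightarrow> bool" where
  "matrix_algorithm d1 d2 \<Omega> S Mhat \<longleftrightarrow>
     (\<forall>y \<in> space (\<Pi>\<^sub>M ij \<in> \<Omega>. borel). \<forall>s \<in> space S. Mhat y s \<in> carrier_mat d1 d2) \<and>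
     (\<forall>i < d1. \<forall>j < d2.
        (\<lambda>(y, s). Mhat y s $$ (i, j)) \<in> borel_measurable ((\<Pi>\<^sub>M ij \<in> \<Omega>. borel) \<Otimes>\<^sub>M S))"

end

theory Submission
  imports Defs "Jordan_Normal_Form.Schur_Decomposition"
begin

text \<open>
  Let \<open>d\<close>, \<open>D\<close> be the smaller and the larger dimension, \<open>\<epsilon>\<close> the claimed error, \<open>a = 4 * sqrt \<epsilon>\<close> and
  \<open>b\<close> the integer part of \<open>r * \<alpha>\<^sup>2 / a\<^sup>2\<close>. Repeating a \<open>b \<times> D\<close> pattern of signs \<open>\<plusminus>a\<close> along the
  smaller dimension gives \<open>2 ^ (b * D)\<close> matrices; they have rank at most \<open>b\<close>, hence nuclear norm at
  most \<open>sqrt b\<close> times the Frobenius norm, and so lie in \<open>K\<close>. An estimate that is \<open>\<epsilon>\<close>-close to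
  two of them forces their patterns to differ in fewer than \<open>b * D / 8\<close> signs, so it is close only to
  the patterns in a Hamming ball, an exponentially small fraction of all. Thus the success events,
  averaged over all patterns, have exponentially small probability under pure noise. Passing
  from pure noise to a shifted Gaussian costs by Cauchy--Schwarz only the second moment
  \<open>exp (n * a\<^sup>2 / \<sigma>\<^sup>2)\<close> of the likelihood ratio, which the choice of \<open>\<epsilon>\<close> keeps smaller than the
  number of patterns. So the average success probability is at most \<open>1 / 4\<close>; this replaces
  a packing set and Fano's inequality by one average over the full cube.
\<close>

no_notation vec_nth (infixl \<open>$\<close> 90)

subsection \<open>Nuclear norm of a product\<close>

lemma char_poly_four_block_upper_right_zero:
  fixes A :: "'a :: idom mat"
  assumes A: "A \<in> carrier_mat n n" and C: "C \<in> carrier_mat m n" and D: "D \<in> carrier_mat m m"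
  shows "char_poly (four_block_mat A (0\<^sub>m n m) C D) = char_poly A * char_poly D"
proof -
  have "char_poly_matrix (four_block_mat A (0\<^sub>m n m) C D) =
      four_block_mat (char_poly_matrix A) (0\<^sub>m n m) (map_mat (\<lambda>a. [:- a:]) C) (char_poly_matrix D)"
    by (rule eq_matI) (use A C D in \<open>auto simp: char_poly_matrix_def one_poly_def\<close>)
  then show ?thesis
    unfolding char_poly_def
    using det_four_block_mat_upper_right_zero[OF char_poly_matrix_closed[OF A] refl _
        char_poly_matrix_closed[OF D], of "map_mat (\<lambda>a. [:- a:]) C"] C
    by simp
qed

lemma char_poly_zero_mat: "char_poly (0\<^sub>m n n :: 'a :: comm_ring_1 mat) = [:0, 1:] ^ n"
proof -
  have "char_poly (0\<^sub>m n n :: 'a mat) = (\<Prod>a\<leftarrow>diag_mat (0\<^sub>m n n :: 'a mat). [:- a, 1:])"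
    by (rule char_poly_upper_triangular[where n = n]) (auto simp: upper_triangular_def)
  also have "diag_mat (0\<^sub>m n n :: 'a mat) = replicate n 0"
    by (auto simp: diag_mat_def list_eq_iff_nth_eq)
  finally show ?thesis
    by simp
qed

text \<open>Both products sit in block lower triangular matrices of size \<open>n + m\<close>,
  padded by zero blocks; these are conjugate by a unipotent block matrix. Each zero block
  contributes a power of the indeterminate. The order of vanishing at 0 can thus be compared between
  a large Gram matrix and a small one.\<close>

lemma char_poly_mult_swap:
  fixes U :: "'a :: idom mat"
  assumes U: "U \<in> carrier_mat n m" and V: "V \<in> carrier_mat m n"
  shows "char_poly (U * V) * [:0, 1:] ^ m = [:0, 1:] ^ n * char_poly (V * U)"
proof -
  let ?M = "four_block_mat (U * V) (0\<^sub>m n m) V (0\<^sub>m m m)"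
  let ?N = "four_block_mat (0\<^sub>m n n) (0\<^sub>m n m) V (V * U)"
  let ?P = "four_block_mat (1\<^sub>m n) U (0\<^sub>m m n) (1\<^sub>m m)"
  let ?Q = "four_block_mat (1\<^sub>m n) (- U) (0\<^sub>m m n) (1\<^sub>m m)"
  note carr = U V mult_carrier_mat[OF U V] mult_carrier_mat[OF V U]
  have PQ: "?P * ?Q = 1\<^sub>m (n + m)"
    using U by (subst mult_four_block_mat[where ?nr1.0=n and ?n1.0=n and ?n2.0=m and ?nr2.0=m
          and ?nc1.0=n and ?nc2.0=m]) (auto intro!: eq_matI)
  have QP: "?Q * ?P = 1\<^sub>m (n + m)"
    using U by (subst mult_four_block_mat[where ?nr1.0=n and ?n1.0=n and ?n2.0=m and ?nr2.0=m
          and ?nc1.0=n and ?nc2.0=m]) (auto intro!: eq_matI)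
  \<comment> \<open>Since \<open>?P\<close> and \<open>?Q\<close> are mutually inverse, conjugacy
    follows from the intertwining relation \<open>?P * ?N = ?M * ?P\<close>, which is checked block
    by block.\<close>
  have NQ: "?P * ?N * ?Q = ?M"
  proof -
    have "?P * ?N = four_block_mat (U * V) (U * (V * U)) V (V * U)"
      using carr by (subst mult_four_block_mat[where ?nr1.0=n and ?n1.0=n and ?n2.0=m and ?nr2.0=m
          and ?nc1.0=n and ?nc2.0=m]) auto
    also have "\<dots> = ?M * ?P"
      using carr assoc_mult_mat[OF U V U]
      by (subst mult_four_block_mat[where ?nr1.0=n and ?n1.0=n and ?n2.0=m and ?nr2.0=m
          and ?nc1.0=n and ?nc2.0=m]) auto
    finally have "?P * ?N * ?Q = ?M * ?P * ?Q"
      by simp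
    also have "\<dots> = ?M * (?P * ?Q)"
      by (rule assoc_mult_mat[where ?n\<^sub>1=\<open>n+m\<close> and ?n\<^sub>2=\<open>n+m\<close> and ?n\<^sub>3=\<open>n+m\<close> and ?n\<^sub>4=\<open>n+m\<close>]) (use carr in auto)
    also have "\<dots> = ?M"
      unfolding PQ using carr by (intro right_mult_one_mat) auto
    finally show ?thesis .
  qed
  have "similar_mat ?M ?N"
    by (rule similar_matI[of _ _ ?P ?Q "n + m"]) (use carr PQ QP NQ in auto)
  then have "char_poly ?M = char_poly ?N"
    by (rule char_poly_similar)
  then show ?thesis
    using char_poly_four_block_upper_right_zero[OF carr(3) V zero_carrier_mat]
      char_poly_four_block_upper_right_zero[OF zero_carrier_mat V carr(4)]
    by (simp add: char_poly_zero_mat)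
qed

section \<open>Traces and the spectrum of Gram matrices\<close>

lemma trace_mult_swap:
  fixes U :: "'a :: comm_semiring_0 mat"
  assumes U: "U \<in> carrier_mat n m" and V: "V \<in> carrier_mat m n"
  shows "(\<Sum>i<n. (U * V) $$ (i, i)) = (\<Sum>j<m. (V * U) $$ (j, j))"
proof -
  have "(\<Sum>i<n. (U * V) $$ (i, i)) = (\<Sum>i<n. \<Sum>j<m. U $$ (i, j) * V $$ (j, i))"
    using U V by (intro sum.cong) (auto simp: scalar_prod_def lessThan_atLeast0)
  also have "\<dots> = (\<Sum>j<m. \<Sum>i<n. V $$ (j, i) * U $$ (i, j))"
    by (subst sum.swap) (simp add: mult.commute)
  also have "\<dots> = (\<Sum>j<m. (V * U) $$ (j, j))"
    using U V by (intro sum.cong) (auto simp: scalar_prod_def lessThan_atLeast0)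
  finally show ?thesis .
qed

text \<open>Schur decomposition makes \<open>A\<close> similar to a triangular matrix with diagonal
  \<open>es\<close>, and cyclicity of the trace removes the similarity.\<close>

lemma sum_list_eigenvalues:
  fixes A :: "'a :: conjugatable_ordered_field mat"
  assumes A: "A \<in> carrier_mat n n" and es: "char_poly A = (\<Prod>e\<leftarrow>es. [:- e, 1:])"
  shows "sum_list es = (\<Sum>i<n. A $$ (i, i))"
proof -
  obtain B P Q where "schur_decomposition A es = (B, P, Q)"
    by (cases "schur_decomposition A es") auto
  from schur_decomposition[OF A es this]
  have sim: "similar_mat_wit A B P Q" and diag: "diag_mat B = es"
    by auto
  from similar_mat_witD2[OF A sim]
  have PQ: "Q * P = 1\<^sub>m n" "A = P * B * Q"
    and carr: "B \<in> carrier_mat n n" "P \<in> carrier_mat n n" "Q \<in> carrier_mat n n"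
    by auto
  have "(\<Sum>i<n. A $$ (i, i)) = (\<Sum>i<n. (Q * (P * B)) $$ (i, i))"
    unfolding PQ(2) using carr by (intro trace_mult_swap) auto
  also have "Q * (P * B) = B"
    using assoc_mult_mat[OF carr(3,2,1)] PQ(1) carr by simp
  also have "(\<Sum>i<n. B $$ (i, i)) = sum_list es"
    unfolding diag[symmetric] diag_mat_def using carr
    by (simp add: interv_sum_list_conv_sum_set_nat atLeast0LessThan)
  finally show ?thesis ..
qed

lemma proots_linear_factors: "proots (\<Prod>e\<leftarrow>es. [:- e, 1:]) = mset (es :: 'a :: idom list)"
proof (induction es)
  case (Cons e es)
  have "proots ([:- e, 1:] * (\<Prod>e\<leftarrow>es. [:- e, 1:])) = {#e#} + proots (\<Prod>e\<leftarrow>es. [:- e, 1:])"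
    by (subst proots_mult) (auto simp: prod_list_zero_iff)
  then show ?case
    using Cons by (simp del: mult_pCons_left)
qed simp

text \<open>For an eigenvector v, pairing the eigenvector equation with v turns the eigenvalue times
  the squared norm of v into the squared norm of A v. So e is a quotient of nonnegative
  reals.\<close>

lemma gram_eigenvalue_nonneg:
  fixes A :: "real mat"
  assumes A: "A \<in> carrier_mat m n"
    and e: "eigenvalue (map_mat complex_of_real (transpose_mat A * A)) e"
  shows "e = complex_of_real (Re e) \<and> 0 \<le> Re e"
proof -
  let ?C = "map_mat complex_of_real"
  from e obtain v where v: "v \<in> carrier_vec n" "v \<noteq> 0\<^sub>v n"
    and Sv: "?C (transpose_mat A * A) *\<^sub>v v = e \<cdot>\<^sub>v v"
    unfolding eigenvalue_def eigenvector_def using A by auto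
  define w where "w = ?C A *\<^sub>v v"
  have w: "w \<in> carrier_vec m"
    unfolding w_def using A v by auto
  have wi: "w $ i = (\<Sum>k<n. complex_of_real (A $$ (i, k)) * v $ k)" if "i < m" for i
    unfolding w_def using that A v by (auto simp: scalar_prod_def lessThan_atLeast0)
  \<comment> \<open>In coordinates, the eigenvector equation says that the transpose of
    \<open>A\<close> sends \<open>w\<close> to \<open>e\<close> times \<open>v\<close>.\<close>
  have ev: "e * v $ j = (\<Sum>i<m. complex_of_real (A $$ (i, j)) * w $ i)" if "j < n" for j
  proof -
    have "e * v $ j = (?C (transpose_mat A * A) *\<^sub>v v) $ j"
      unfolding Sv using that v by simp
    also have "\<dots> = (\<Sum>k<n. complex_of_real (\<Sum>i<m. A $$ (i, j) * A $$ (i, k)) * v $ k)"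
      using that A v by (auto simp: scalar_prod_def lessThan_atLeast0)
    also have "\<dots> = (\<Sum>k<n. \<Sum>i<m. complex_of_real (A $$ (i, j)) * (complex_of_real (A $$ (i, k)) * v $ k))"
      by (simp add: sum_distrib_right sum_distrib_left mult.assoc)
    also have "\<dots> = (\<Sum>i<m. \<Sum>k<n. complex_of_real (A $$ (i, j)) * (complex_of_real (A $$ (i, k)) * v $ k))"
      by (rule sum.swap)
    also have "\<dots> = (\<Sum>i<m. complex_of_real (A $$ (i, j)) * w $ i)"
      by (intro sum.cong refl) (simp add: wi sum_distrib_left)
    finally show ?thesis .
  qed
  have "e * complex_of_real (\<Sum>j<n. (cmod (v $ j))\<^sup>2) = (\<Sum>j<n. (e * v $ j) * cnj (v $ j))"
    by (simp add: sum_distrib_left mult.assoc complex_norm_square del: of_real_power)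
  also have "\<dots> = (\<Sum>j<n. \<Sum>i<m. w $ i * (complex_of_real (A $$ (i, j)) * cnj (v $ j)))"
    by (intro sum.cong refl) (simp add: ev sum_distrib_right sum_distrib_left mult_ac)
  also have "\<dots> = (\<Sum>i<m. \<Sum>j<n. w $ i * (complex_of_real (A $$ (i, j)) * cnj (v $ j)))"
    by (rule sum.swap)
  also have "\<dots> = (\<Sum>i<m. w $ i * cnj (w $ i))"
    by (intro sum.cong refl) (simp add: wi sum_distrib_left)
  also have "\<dots> = complex_of_real (\<Sum>i<m. (cmod (w $ i))\<^sup>2)"
    by (simp add: complex_norm_square del: of_real_power)
  finally have eq: "e * complex_of_real (\<Sum>j<n. (cmod (v $ j))\<^sup>2) = complex_of_real (\<Sum>i<m. (cmod (w $ i))\<^sup>2)" .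
  from v obtain j where "j < n" "v $ j \<noteq> 0"
    by (metis eq_vecI carrier_vecD index_zero_vec)
  then have pos: "(\<Sum>j<n. (cmod (v $ j))\<^sup>2) > 0"
    by (intro sum_pos2[of _ j]) auto
  with eq have "e = complex_of_real ((\<Sum>i<m. (cmod (w $ i))\<^sup>2) / (\<Sum>j<n. (cmod (v $ j))\<^sup>2))"
    by (subst of_real_divide, subst nonzero_eq_divide_eq) (auto simp del: of_real_sum)
  moreover have "(\<Sum>i<m. (cmod (w $ i))\<^sup>2) / (\<Sum>j<n. (cmod (v $ j))\<^sup>2) \<ge> 0"
    by (intro divide_nonneg_nonneg sum_nonneg) auto
  ultimately show ?thesis
    by (metis Re_complex_of_real)
qed

text \<open>The polynomial splits over the complex numbers; all roots are real by the previous
  lemma, and the embedding of real polynomials into complex ones is injective, so the factorization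
  descends.\<close>

lemma gram_char_poly_factorized:
  fixes A :: "real mat"
  assumes A: "A \<in> carrier_mat m n"
  obtains es where "char_poly (transpose_mat A * A) = (\<Prod>e\<leftarrow>es. [:- e, 1:])"
    "length es = n" "\<And>e. e \<in> set es \<Longrightarrow> 0 \<le> e"
proof -
  let ?S = "transpose_mat A * A" and ?h = complex_of_real
  interpret h: map_poly_inj_comm_ring_hom ?h ..
  have S: "?S \<in> carrier_mat n n"
    using A by auto
  then have CS: "map_mat ?h ?S \<in> carrier_mat n n"
    by simp
  from char_poly_factorized[OF CS] obtain as
    where as: "char_poly (map_mat ?h ?S) = (\<Prod>a\<leftarrow>as. [:- a, 1:])" "length as = n"
    by blast
  have real: "a = ?h (Re a) \<and> 0 \<le> Re a" if "a \<in> set as" for a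
  proof (rule gram_eigenvalue_nonneg[OF A])
    have "poly (char_poly (map_mat ?h ?S)) a = 0"
      unfolding as using that by (auto simp: poly_prod_list prod_list_zero_iff)
    then show "eigenvalue (map_mat ?h ?S) a"
      using eigenvalue_root_char_poly[OF CS] by simp
  qed
  have "map_poly ?h (char_poly ?S) = (\<Prod>a\<leftarrow>as. [:- a, 1:])"
    using as of_real_hom.char_poly_hom[OF S, symmetric] by metis
  also have "\<dots> = (\<Prod>a\<leftarrow>as. map_poly ?h [:- Re a, 1:])"
    by (intro arg_cong[where f = prod_list] map_cong refl) (use real in auto)
  also have "\<dots> = map_poly ?h (\<Prod>e\<leftarrow>map Re as. [:- e, 1:])"
    by (induction as) (simp_all add: h.hom_mult del: mult_pCons_left mult_pCons_right)
  finally have "char_poly ?S = (\<Prod>e\<leftarrow>map Re as. [:- e, 1:])"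
    by (rule h.injectivity)
  then show ?thesis
    by (rule that) (use as real in auto)
qed

lemma gram_trace:
  fixes A :: "real mat"
  assumes A: "A \<in> carrier_mat m n"
  shows "(\<Sum>j<n. (transpose_mat A * A) $$ (j, j)) = (frobenius_norm A)\<^sup>2"
proof -
  have "(\<Sum>j<n. (transpose_mat A * A) $$ (j, j)) = (\<Sum>j<n. \<Sum>i<m. (A $$ (i, j))\<^sup>2)"
    using A by (intro sum.cong) (auto simp: scalar_prod_def lessThan_atLeast0 power2_eq_square)
  also have "\<dots> = (frobenius_norm A)\<^sup>2"
    unfolding frobenius_norm_def using A by (subst sum.swap) (simp add: sum_nonneg)
  finally show ?thesis .
qed

text \<open>Factoring through dimension \<open>b\<close> leaves the Gram matrix at most
  \<open>b\<close> nonzero eigenvalues. Cauchy--Schwarz over these bounds the sum of their square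
  roots by the square root of \<open>b\<close> times their sum, and that sum is the trace, the
  squared Frobenius norm.\<close>

lemma nuclear_norm_mult_le:
  fixes P Q :: "real mat"
  assumes P: "P \<in> carrier_mat m b" and Q: "Q \<in> carrier_mat b n"
  shows "nuclear_norm (P * Q) \<le> sqrt (real b) * frobenius_norm (P * Q)"
proof -
  let ?A = "P * Q" let ?S = "transpose_mat ?A * ?A"
  have A: "?A \<in> carrier_mat m n" and S: "?S \<in> carrier_mat n n"
    using P Q by auto
  from gram_char_poly_factorized[OF A] obtain es
    where es: "char_poly ?S = (\<Prod>e\<leftarrow>es. [:- e, 1:])" "length es = n" "\<And>e. e \<in> set es \<Longrightarrow> 0 \<le> e"
    by blast
  define I where "I = {i. i < n \<and> es ! i \<noteq> 0}"
  have I: "finite I" "I \<subseteq> {..<n}"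
    unfolding I_def by auto
  let ?V = "transpose_mat P * ?A"
  have V: "?V \<in> carrier_mat b n" and QT: "transpose_mat Q \<in> carrier_mat n b"
    using P Q by auto
  have SV: "?S = transpose_mat Q * ?V"
    using P Q assoc_mult_mat[of "transpose_mat Q" n b "transpose_mat P" m ?A n]
    by (simp add: transpose_mult[OF P Q])
  have nz: "char_poly ?S \<noteq> 0"
    using es(1) by (auto simp: prod_list_zero_iff)
  have VQ: "?V * transpose_mat Q \<in> carrier_mat b b"
    using V QT by simp
  \<comment> \<open>Comparing orders at 0 on both sides of the swap identity shows that 0 has
    multiplicity at least \<open>n - b\<close> in the characteristic polynomial of
    \<open>?S\<close>.\<close>
  have "n \<le> Polynomial.order 0 ([:0, 1:] ^ n * char_poly (?V * transpose_mat Q))"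
  proof (subst order_mult)
    show "[:0, 1:] ^ n * char_poly (?V * transpose_mat Q) \<noteq> 0"
      using degree_monic_char_poly[OF VQ] by (auto simp: monom_altdef[symmetric])
    show "n \<le> Polynomial.order 0 ([:0, 1::real:] ^ n) + Polynomial.order 0 (char_poly (?V * transpose_mat Q))"
      using order_power_n_n[of "0::real" n] by simp
  qed
  also have "[:0, 1:] ^ n * char_poly (?V * transpose_mat Q) = char_poly ?S * [:0, 1:] ^ b"
    unfolding SV by (rule char_poly_mult_swap[OF QT V, symmetric])
  also have "Polynomial.order 0 \<dots> = Polynomial.order 0 (char_poly ?S) + b"
    using nz order_power_n_n[of "0::real" b] by (subst order_mult) auto
  also have "Polynomial.order 0 (char_poly ?S) = count (mset es) 0"
    using nz by (metis count_proots es(1) proots_linear_factors)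
  also have "\<dots> = card ({..<n} - I)"
    unfolding I_def count_mset es(2)[symmetric] count_list_eq_length_filter length_filter_conv_card
    by (intro arg_cong[where f = card]) auto
  also have "\<dots> = n - card I"
    using I by (simp add: card_Diff_subset)
  finally have cardI: "card I \<le> b"
    using card_mono[OF _ I(2)] by simp
  have "nuclear_norm ?A = (\<Sum>i<n. sqrt (es ! i))"
    unfolding nuclear_norm_def singular_values_def es(1) proots_linear_factors
    by (simp add: sum_mset_sum_list mset_map[symmetric] del: mset_map)
       (simp add: sum_list_sum_nth es(2) atLeast0LessThan)
  also have "\<dots> = (\<Sum>i\<in>I. sqrt (es ! i))"
    using I by (intro sum.mono_neutral_right) (auto simp: I_def)
  also have "\<dots> \<le> sqrt ((\<Sum>i\<in>I. (sqrt (es ! i))\<^sup>2) * card I)"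
    by (rule real_le_rsqrt) (rule sum_squared_le_sum_of_squares)
  also have "(\<Sum>i\<in>I. (sqrt (es ! i))\<^sup>2) = (\<Sum>i\<in>I. es ! i)"
    using es(2,3) I by (intro sum.cong) auto
  also have "\<dots> = (\<Sum>i<n. es ! i)"
    using I by (intro sum.mono_neutral_left) (auto simp: I_def)
  also have "\<dots> = (frobenius_norm ?A)\<^sup>2"
    using sum_list_eigenvalues[OF S es(1)] gram_trace[OF A]
    by (simp add: sum_list_sum_nth es(2) atLeast0LessThan)
  also have "sqrt ((frobenius_norm ?A)\<^sup>2 * card I) \<le> sqrt ((frobenius_norm ?A)\<^sup>2 * b)"
    using cardI by (intro real_sqrt_le_mono mult_left_mono) auto
  also have "\<dots> = sqrt (real b) * frobenius_norm ?A"
    by (simp add: real_sqrt_mult frobenius_norm_def sum_nonneg)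
  finally show ?thesis .
qed

subsection \<open>Gaussian shifts\<close>

abbreviation centered_gaussian :: "real \<Rightarrow> real measure" where
  "centered_gaussian \<sigma> \<equiv> density lborel (\<lambda>x. ennreal (normal_density 0 \<sigma> x))"

text \<open>The likelihood ratio at \<open>x\<close> of the normal law with mean \<open>m\<close>
  against the centered one, both with variance \<open>\<sigma>\<^sup>2\<close>.\<close>

definition gaussian_shift_ratio :: "real \<Rightarrow> real \<Rightarrow> real \<Rightarrow> real" where
  "gaussian_shift_ratio \<sigma> m x = exp ((2 * m * x - m\<^sup>2) / (2 * \<sigma>\<^sup>2))"

lemma gaussian_shift_ratio_measurable [measurable]:
  "gaussian_shift_ratio \<sigma> m \<in> borel_measurable borel"
  unfolding gaussian_shift_ratio_def by measurable

lemma gaussian_shift_ratio_nonneg: "0 \<le> gaussian_shift_ratio \<sigma> m x"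
  unfolding gaussian_shift_ratio_def by simp

text \<open>Doubling the exponent doubles its linear term, so completing it to the ratio for the
  shift \<open>2 * m\<close> leaves a factor free of \<open>x\<close>. For
  \<open>\<sigma> = 0\<close> every quotient is 0 by convention and both sides are 1.\<close>

lemma gaussian_shift_ratio_square:
  "(gaussian_shift_ratio \<sigma> m x)\<^sup>2 = exp (m\<^sup>2 / \<sigma>\<^sup>2) * gaussian_shift_ratio \<sigma> (2 * m) x"
  unfolding gaussian_shift_ratio_def exp_double[symmetric] exp_add[symmetric]
  by (rule arg_cong[where f = exp]) (cases "\<sigma> = 0"; simp add: field_simps power2_eq_square)

lemma normal_density_mult_shift_ratio:
  "normal_density 0 \<sigma> x * gaussian_shift_ratio \<sigma> m x = normal_density 0 \<sigma> (x - m)"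
proof -
  have "exp (- x\<^sup>2 / (2 * \<sigma>\<^sup>2)) * exp ((2 * m * x - m\<^sup>2) / (2 * \<sigma>\<^sup>2)) = exp (- (x - m)\<^sup>2 / (2 * \<sigma>\<^sup>2))"
    unfolding exp_add[symmetric]
    by (rule arg_cong[where f = exp]) (cases "\<sigma> = 0"; simp add: field_simps power2_eq_square)
  then show ?thesis
    unfolding normal_density_def gaussian_shift_ratio_def by simp
qed

lemma prob_space_centered_gaussian: "\<sigma> > 0 \<Longrightarrow> prob_space (centered_gaussian \<sigma>)"
  by (rule prob_space_normal_density)

lemma emeasure_gaussian_shift:
  assumes [measurable]: "A \<in> sets borel"
  shows "emeasure (centered_gaussian \<sigma>) {x. m + x \<in> A} =
    (\<integral>\<^sup>+x. ennreal (gaussian_shift_ratio \<sigma> m x) * indicator A x \<partial>centered_gaussian \<sigma>)"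
proof -
  have "emeasure (centered_gaussian \<sigma>) {x. m + x \<in> A} =
      (\<integral>\<^sup>+x. ennreal (normal_density 0 \<sigma> x) * indicator A (m + x) \<partial>lborel)"
    by (subst emeasure_density) (auto intro!: nn_integral_cong simp: indicator_def)
  \<comment> \<open>Translation invariance of Lebesgue measure: \<open>lborel\<close> is rewritten
    as its own image under the shift by \<open>- m\<close>, which sets up the substitution.\<close>
  also have "\<dots> = (\<integral>\<^sup>+x. ennreal (normal_density 0 \<sigma> x) * indicator A (m + x)
      \<partial>distr lborel borel (\<lambda>x. (- m) + x))"
    by (subst lborel_distr_plus) simp
  also have "\<dots> = (\<integral>\<^sup>+x. ennreal (normal_density 0 \<sigma> (x - m)) * indicator A x \<partial>lborel)"
    by (subst nn_integral_distr) auto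
  also have "\<dots> = (\<integral>\<^sup>+x. ennreal (gaussian_shift_ratio \<sigma> m x) * indicator A x \<partial>centered_gaussian \<sigma>)"
    by (subst nn_integral_density)
       (auto intro!: nn_integral_cong simp: normal_density_mult_shift_ratio[symmetric] ennreal_mult
          gaussian_shift_ratio_nonneg mult.assoc)
  finally show ?thesis .
qed

text \<open>Both measures are identified with the product of the one-dimensional shifted laws. By
  uniqueness of product measures it suffices to compare them on boxes, where both values
  factorize.\<close>

lemma distr_PiM_gaussian_shift:
  fixes m :: "'i \<Rightarrow> real"
  assumes I [simp]: "finite I" and \<sigma>: "\<sigma> > 0"
  defines "N \<equiv> PiM I (\<lambda>_. centered_gaussian \<sigma>)"
  shows "distr N N (\<lambda>Z. \<lambda>i\<in>I. m i + Z i) =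
    density N (\<lambda>Z. ennreal (\<Prod>i\<in>I. gaussian_shift_ratio \<sigma> (m i) (Z i)))"
proof -
  let ?G = "centered_gaussian \<sigma>"
  let ?L = "\<lambda>i x. ennreal (gaussian_shift_ratio \<sigma> (m i) x)"
  have prob: "prob_space (density ?G (?L i))" for i
  proof (rule prob_spaceI)
    have "emeasure (density ?G (?L i)) UNIV = emeasure ?G {x. m i + x \<in> UNIV}"
      by (subst emeasure_gaussian_shift) (auto simp: emeasure_density)
    then show "emeasure (density ?G (?L i)) (space (density ?G (?L i))) = 1"
      using prob_space.emeasure_space_1[OF prob_space_centered_gaussian[OF \<sigma>]] by simp
  qed
  interpret G: product_sigma_finite "\<lambda>_::'i. ?G"
    by (rule product_sigma_finite.intro)
       (rule prob_space_imp_sigma_finite[OF prob_space_centered_gaussian[OF \<sigma>]])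
  interpret D: product_sigma_finite "\<lambda>i. density ?G (?L i)"
    by (rule product_sigma_finite.intro) (rule prob_space_imp_sigma_finite[OF prob])
  have sets_D: "sets (PiM I (\<lambda>i. density ?G (?L i))) = sets N"
    unfolding N_def by (intro sets_PiM_cong) auto
  have sets_N: "sets N = sets (PiM I (\<lambda>_. borel))"
    unfolding N_def by (intro sets_PiM_cong) auto
  have space_N: "space N = PiE I (\<lambda>_. UNIV)"
    unfolding N_def by (simp add: space_PiM)
  have meas [measurable]: "(\<lambda>Z. \<lambda>i\<in>I. m i + Z i) \<in> measurable N N"
    unfolding measurable_cong_sets[OF sets_N sets_N] by measurable
  have emeas: "emeasure (density ?G (?L i)) A = emeasure ?G {x. m i + x \<in> A}"
    if [measurable]: "A \<in> sets borel" for i A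
    by (subst emeasure_gaussian_shift) (auto simp: emeasure_density)
  have "distr N N (\<lambda>Z. \<lambda>i\<in>I. m i + Z i) = PiM I (\<lambda>i. density ?G (?L i))"
  proof (rule D.PiM_eqI)
    fix A :: "'i \<Rightarrow> real set"
    assume "\<And>i. i \<in> I \<Longrightarrow> A i \<in> sets (density ?G (?L i))"
    then have A [measurable]: "\<And>i. i \<in> I \<Longrightarrow> A i \<in> sets borel"
      by simp
    have box: "PiE I A \<in> sets N"
      unfolding sets_N using A by (intro sets_PiM_I_finite) auto
    have "emeasure (distr N N (\<lambda>Z. \<lambda>i\<in>I. m i + Z i)) (PiE I A) =
        emeasure N (PiE I (\<lambda>i. {x. m i + x \<in> A i}))"
      by (subst emeasure_distr[OF meas box])
         (auto intro!: arg_cong[where f = "emeasure N"] simp: space_N PiE_iff extensional_def)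
    also have "\<dots> = (\<Prod>i\<in>I. emeasure ?G {x. m i + x \<in> A i})"
      unfolding N_def by (rule G.emeasure_PiM) auto
    also have "\<dots> = (\<Prod>i\<in>I. emeasure (density ?G (?L i)) (A i))"
      using A by (intro prod.cong) (auto simp: emeas)
    finally show "emeasure (distr N N (\<lambda>Z. \<lambda>i\<in>I. m i + Z i)) (PiE I A) = \<dots>" .
  qed (simp_all add: sets_D)
  moreover have "density N (\<lambda>Z. ennreal (\<Prod>i\<in>I. gaussian_shift_ratio \<sigma> (m i) (Z i))) =
      PiM I (\<lambda>i. density ?G (?L i))"
  proof (rule D.PiM_eqI)
    fix A :: "'i \<Rightarrow> real set"
    assume "\<And>i. i \<in> I \<Longrightarrow> A i \<in> sets (density ?G (?L i))"
    then have A [measurable]: "\<And>i. i \<in> I \<Longrightarrow> A i \<in> sets borel"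
      by simp
    have box: "PiE I A \<in> sets N"
      unfolding sets_N using A by (intro sets_PiM_I_finite) auto
    have "emeasure (density N (\<lambda>Z. ennreal (\<Prod>i\<in>I. gaussian_shift_ratio \<sigma> (m i) (Z i)))) (PiE I A) =
        (\<integral>\<^sup>+Z. ennreal (\<Prod>i\<in>I. gaussian_shift_ratio \<sigma> (m i) (Z i)) * indicator (PiE I A) Z \<partial>N)"
      using box by (subst emeasure_density) (auto simp: N_def)
    also have "\<dots> = (\<integral>\<^sup>+Z. (\<Prod>i\<in>I. ?L i (Z i) * indicator (A i) (Z i)) \<partial>N)"
    proof (rule nn_integral_cong)
      fix Z assume "Z \<in> space N"
      \<comment> \<open>The factorization uses that points of the space are extensional; membership
        in \<open>PiE I A\<close> is then purely coordinatewise.\<close>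
      then have "indicator (PiE I A) Z = (\<Prod>i\<in>I. indicator (A i) (Z i) :: ennreal)"
        by (auto simp: space_N indicator_def PiE_iff prod.neutral)
      then show "ennreal (\<Prod>i\<in>I. gaussian_shift_ratio \<sigma> (m i) (Z i)) * indicator (PiE I A) Z =
          (\<Prod>i\<in>I. ?L i (Z i) * indicator (A i) (Z i))"
        by (simp add: prod.distrib prod_ennreal gaussian_shift_ratio_nonneg)
    qed
    also have "\<dots> = (\<Prod>i\<in>I. \<integral>\<^sup>+x. ?L i x * indicator (A i) x \<partial>?G)"
      unfolding N_def by (rule G.product_nn_integral_prod) auto
    also have "\<dots> = (\<Prod>i\<in>I. emeasure (density ?G (?L i)) (A i))"
      using A by (intro prod.cong) (auto simp: emeasure_density)
    finally show "emeasure (density N (\<lambda>Z. ennreal (\<Prod>i\<in>I. gaussian_shift_ratio \<sigma> (m i) (Z i)))) (PiE I A) = \<dots>" .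
  qed (simp_all add: sets_D)
  ultimately show ?thesis
    by simp
qed

text \<open>
  Below \<open>L\<close> is the likelihood ratio, and \<open>L \<le> t L\<^sup>2 / 2 + 1 / (2 t)\<close> on \<open>G\<close>, where
  \<open>L\<^sup>2\<close> has mean \<open>exp (\<parallel>m\<parallel>\<^sup>2 / \<sigma>\<^sup>2)\<close> because it is a multiple of the likelihood ratio for the
  shift \<open>2 m\<close>.
\<close>

lemma gaussian_shift_measure_le:
  fixes m :: "'i \<Rightarrow> real"
  assumes I: "finite I" and \<sigma>: "\<sigma> > 0" and S: "prob_space S" and t: "t > 0"
  defines "N \<equiv> PiM I (\<lambda>_. centered_gaussian \<sigma>)"
  assumes G [measurable]: "G \<in> sets (N \<Otimes>\<^sub>M S)"
  shows "measure (N \<Otimes>\<^sub>M S) {p \<in> space (N \<Otimes>\<^sub>M S). ((\<lambda>i\<in>I. m i + fst p i), snd p) \<in> G}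
    \<le> t / 2 * exp ((\<Sum>i\<in>I. (m i)\<^sup>2) / \<sigma>\<^sup>2) + measure (N \<Otimes>\<^sub>M S) G / (2 * t)"
proof -
  let ?shift = "\<lambda>Z. \<lambda>i\<in>I. m i + Z i"
  define L where "L m' Z = (\<Prod>i\<in>I. gaussian_shift_ratio \<sigma> (m' i) (Z i))" for m' Z
  let ?A = "(\<Sum>i\<in>I. (m i)\<^sup>2) / \<sigma>\<^sup>2"
  have L_nonneg: "0 \<le> L m' Z" for m' Z
    unfolding L_def by (intro prod_nonneg) (simp add: gaussian_shift_ratio_nonneg)
  interpret S: prob_space S by fact
  interpret N: prob_space N
    unfolding N_def by (intro prob_space_PiM prob_space_centered_gaussian \<sigma>)
  interpret P: pair_prob_space N S ..
  have sets_N: "sets N = sets (PiM I (\<lambda>_. borel))"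
    unfolding N_def by (intro sets_PiM_cong) auto
  have shift [measurable]: "(\<lambda>Z. \<lambda>i\<in>I. m' i + Z i) \<in> measurable N N" for m' :: "'i \<Rightarrow> real"
    unfolding measurable_cong_sets[OF sets_N sets_N] by measurable
  have L_meas [measurable]: "L m' \<in> borel_measurable N" for m'
    unfolding L_def N_def by measurable
  have distr: "distr N N (\<lambda>Z. \<lambda>i\<in>I. m' i + Z i) = density N (\<lambda>Z. ennreal (L m' Z))" for m'
    unfolding L_def N_def by (rule distr_PiM_gaussian_shift[OF I \<sigma>])
  \<comment> \<open>Stated for every shift, because after squaring it is the ratio for the doubled
    shift that is integrated.\<close>
  have L_int: "(\<integral>\<^sup>+Z. ennreal (L m' Z) \<partial>N) = 1" for m'
  proof -
    have "(\<integral>\<^sup>+Z. ennreal (L m' Z) \<partial>N) = emeasure (density N (\<lambda>Z. ennreal (L m' Z))) (space N)"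
      by (subst emeasure_density) (auto intro!: nn_integral_cong)
    also have "\<dots> = 1"
      unfolding distr[symmetric] using prob_space.emeasure_space_1[OF N.prob_space_distr[OF shift]]
      by simp
    finally show ?thesis .
  qed
  have L_square: "(L m Z)\<^sup>2 = exp ?A * L (\<lambda>i. 2 * m i) Z" for Z
    unfolding L_def prod_power_distrib gaussian_shift_ratio_square prod.distrib
    by (simp add: exp_sum[OF I, symmetric] sum_divide_distrib)
  let ?E = "{p \<in> space (N \<Otimes>\<^sub>M S). (?shift (fst p), snd p) \<in> G}"
  have E [measurable]: "?E \<in> sets (N \<Otimes>\<^sub>M S)"
    by measurable
  have "emeasure (N \<Otimes>\<^sub>M S) ?E = (\<integral>\<^sup>+p. indicator ?E p \<partial>(N \<Otimes>\<^sub>M S))"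
    by simp
  also have "\<dots> = (\<integral>\<^sup>+p. indicator G (?shift (fst p), snd p) \<partial>(N \<Otimes>\<^sub>M S))"
    by (intro nn_integral_cong) (auto simp: indicator_def)
  \<comment> \<open>The noise is integrated first, with the seed fixed, so that the change of
    measure concerns \<open>N\<close> alone.\<close>
  also have "\<dots> = (\<integral>\<^sup>+s. \<integral>\<^sup>+Z. indicator G (?shift Z, s) \<partial>N \<partial>S)"
    by (subst P.nn_integral_snd[symmetric]) auto
  also have "\<dots> = (\<integral>\<^sup>+s. \<integral>\<^sup>+Z. ennreal (L m Z) * indicator G (Z, s) \<partial>N \<partial>S)"
  proof (rule nn_integral_cong)
    fix s assume [measurable]: "s \<in> space S"
    have "(\<integral>\<^sup>+Z. indicator G (?shift Z, s) \<partial>N) = (\<integral>\<^sup>+Z. indicator G (Z, s) \<partial>distr N N ?shift)"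
      by (subst nn_integral_distr) auto
    also have "\<dots> = (\<integral>\<^sup>+Z. ennreal (L m Z) * indicator G (Z, s) \<partial>N)"
      unfolding distr by (subst nn_integral_density) auto
    finally show "(\<integral>\<^sup>+Z. indicator G (?shift Z, s) \<partial>N) = (\<integral>\<^sup>+Z. ennreal (L m Z) * indicator G (Z, s) \<partial>N)" .
  qed
  also have "\<dots> \<le> (\<integral>\<^sup>+s. \<integral>\<^sup>+Z. ennreal (t / 2 * exp ?A) * ennreal (L (\<lambda>i. 2 * m i) Z)
      + ennreal (1 / (2 * t)) * indicator G (Z, s) \<partial>N \<partial>S)"
  proof (intro nn_integral_mono)
    fix s Z
    have "0 \<le> (t * L m Z - 1)\<^sup>2 / (2 * t)"
      using t by simp
    also have "\<dots> = t / 2 * (L m Z)\<^sup>2 + 1 / (2 * t) - L m Z"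
      using t by (simp add: field_simps power2_eq_square)
    finally have "L m Z \<le> t / 2 * exp ?A * L (\<lambda>i. 2 * m i) Z + 1 / (2 * t)"
      unfolding L_square by simp
    then have "ennreal (L m Z) \<le> ennreal (t / 2 * exp ?A) * ennreal (L (\<lambda>i. 2 * m i) Z) + ennreal (1 / (2 * t))"
      using t L_nonneg by (simp add: ennreal_mult[symmetric] ennreal_plus[symmetric] ennreal_leI del: ennreal_plus)
    then show "ennreal (L m Z) * indicator G (Z, s) \<le> ennreal (t / 2 * exp ?A) * ennreal (L (\<lambda>i. 2 * m i) Z)
      + ennreal (1 / (2 * t)) * indicator G (Z, s)"
      by (simp add: indicator_def)
  qed
  also have "\<dots> = (\<integral>\<^sup>+s. ennreal (t / 2 * exp ?A)
      + (\<integral>\<^sup>+Z. ennreal (1 / (2 * t)) * indicator G (Z, s) \<partial>N) \<partial>S)"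
    by (intro nn_integral_cong, subst nn_integral_add) (auto simp: nn_integral_cmult L_int)
  also have "\<dots> = ennreal (t / 2 * exp ?A) +
      (\<integral>\<^sup>+s. \<integral>\<^sup>+Z. ennreal (1 / (2 * t)) * indicator G (Z, s) \<partial>N \<partial>S)"
    by (subst nn_integral_add) (auto simp: S.emeasure_space_1)
  also have "(\<integral>\<^sup>+s. \<integral>\<^sup>+Z. ennreal (1 / (2 * t)) * indicator G (Z, s) \<partial>N \<partial>S) =
      (\<integral>\<^sup>+p. ennreal (1 / (2 * t)) * indicator G p \<partial>(N \<Otimes>\<^sub>M S))"
    by (subst P.nn_integral_snd[symmetric]) auto
  also have "\<dots> = ennreal (1 / (2 * t)) * emeasure (N \<Otimes>\<^sub>M S) G"
    by (simp add: nn_integral_cmult)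
  finally show ?thesis
    unfolding P.emeasure_eq_measure
    using t by (simp add: ennreal_mult[symmetric] ennreal_plus[symmetric] del: ennreal_plus)
qed

text \<open>The sum over \<open>W\<close> of the unshifted probabilities is the mean number of
  events containing a random point, hence at most \<open>V\<close>. After the change of measure the
  average probability is at most 1/8 from the second moment plus 1/8 from this overlap, so some
  member of \<open>W\<close> does no worse than the average.\<close>

lemma gaussian_testing:
  fixes m :: "'w \<Rightarrow> 'i \<Rightarrow> real"
  assumes I: "finite I" and \<sigma>: "\<sigma> > 0" and S: "prob_space S"
    and W: "finite W" "W \<noteq> {}"
  defines "N \<equiv> PiM I (\<lambda>_. centered_gaussian \<sigma>)"
  assumes G: "\<And>w. w \<in> W \<Longrightarrow> G w \<in> sets (N \<Otimes>\<^sub>M S)"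
    and overlap: "\<And>p. p \<in> space (N \<Otimes>\<^sub>M S) \<Longrightarrow> real (card {w \<in> W. p \<in> G w}) \<le> V"
    and energy: "\<And>w. w \<in> W \<Longrightarrow> (\<Sum>i\<in>I. (m w i)\<^sup>2) / \<sigma>\<^sup>2 \<le> A"
    and V: "16 * exp A * V \<le> real (card W)"
  shows "\<exists>w\<in>W. measure (N \<Otimes>\<^sub>M S)
    {p \<in> space (N \<Otimes>\<^sub>M S). ((\<lambda>i\<in>I. m w i + fst p i), snd p) \<in> G w} \<le> 1 / 4"
proof -
  interpret S: prob_space S by fact
  interpret N: prob_space N
    unfolding N_def by (intro prob_space_PiM prob_space_centered_gaussian \<sigma>)
  interpret P: pair_prob_space N S ..
  let ?\<mu> = "\<lambda>w. measure (N \<Otimes>\<^sub>M S)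
    {p \<in> space (N \<Otimes>\<^sub>M S). ((\<lambda>i\<in>I. m w i + fst p i), snd p) \<in> G w}"
  have le: "?\<mu> w \<le> 1 / 8 + 2 * exp A * P.prob (G w)" if w: "w \<in> W" for w
  proof -
    \<comment> \<open>The parameter \<open>t = exp (- A) / 4\<close> makes the second-moment term at
      most 1/8.\<close>
    have "?\<mu> w \<le> (exp (- A) / 4) / 2 * exp ((\<Sum>i\<in>I. (m w i)\<^sup>2) / \<sigma>\<^sup>2) + P.prob (G w) / (2 * (exp (- A) / 4))"
      unfolding N_def
      by (rule gaussian_shift_measure_le[OF I \<sigma> S]) (use G[OF w] in \<open>auto simp: N_def\<close>)
    moreover have "(exp (- A) / 4) / 2 * exp ((\<Sum>i\<in>I. (m w i)\<^sup>2) / \<sigma>\<^sup>2) \<le> (exp (- A) / 4) / 2 * exp A"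
      using energy[OF w] by simp
    moreover have "(exp (- A) / 4) / 2 * exp A = 1 / 8"
      by (simp add: exp_minus)
    moreover have "P.prob (G w) / (2 * (exp (- A) / 4)) = 2 * exp A * P.prob (G w)"
      by (simp add: exp_minus field_simps)
    ultimately show ?thesis
      by linarith
  qed
  have "(\<Sum>w\<in>W. P.prob (G w)) = (\<Sum>w\<in>W. \<integral>p. indicator (G w) p \<partial>(N \<Otimes>\<^sub>M S))"
    using G by (intro sum.cong) (auto dest: sets.sets_into_space simp: Int_absorb2)
  also have "\<dots> = (\<integral>p. (\<Sum>w\<in>W. indicator (G w) p) \<partial>(N \<Otimes>\<^sub>M S))"
    using G by (intro Bochner_Integration.integral_sum[symmetric])
      (auto intro!: integrable_real_indicator simp: P.emeasure_eq_measure)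
  also have "\<dots> \<le> (\<integral>p. V \<partial>(N \<Otimes>\<^sub>M S))"
  proof (rule integral_mono)
    show "integrable (N \<Otimes>\<^sub>M S) (\<lambda>p. \<Sum>w\<in>W. indicator (G w) p :: real)"
      using G by (intro Bochner_Integration.integrable_sum)
        (auto intro!: integrable_real_indicator simp: P.emeasure_eq_measure)
    fix p assume p: "p \<in> space (N \<Otimes>\<^sub>M S)"
    have "(\<Sum>w\<in>W. indicator (G w) p :: real) = real (card {w \<in> W. p \<in> G w})"
      using W(1) by (simp add: indicator_def sum.If_cases Int_def)
    then show "(\<Sum>w\<in>W. indicator (G w) p :: real) \<le> V"
      using overlap[OF p] by simp
  qed simp
  also have "\<dots> = V"
    by (simp add: P.prob_space)
  finally have sum_prob: "(\<Sum>w\<in>W. P.prob (G w)) \<le> V" .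
  have "(\<Sum>w\<in>W. ?\<mu> w) \<le> (\<Sum>w\<in>W. 1 / 8 + 2 * exp A * P.prob (G w))"
    by (intro sum_mono le)
  also have "\<dots> = real (card W) / 8 + 2 * exp A * (\<Sum>w\<in>W. P.prob (G w))"
    by (simp add: sum.distrib sum_distrib_left)
  also have "\<dots> \<le> real (card W) / 8 + 2 * exp A * V"
    using sum_prob by simp
  also have "\<dots> \<le> real (card W) / 4"
    using V by simp
  finally have sum_le: "(\<Sum>w\<in>W. ?\<mu> w) \<le> real (card W) / 4" .
  show ?thesis
  proof (rule ccontr)
    assume "\<not> ?thesis"
    then have "\<And>w. w \<in> W \<Longrightarrow> 1 / 4 < ?\<mu> w"
      by (auto simp: not_le)
    then have "(\<Sum>w\<in>W. 1 / 4) < (\<Sum>w\<in>W. ?\<mu> w)"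
      using W by (intro sum_strict_mono) auto
    with sum_le show False
      by simp
  qed
qed

subsection \<open>Hamming balls and periodic sign matrices\<close>

lemma sum_Pow_power_card:
  fixes x :: "'a :: comm_semiring_1"
  assumes "finite T"
  shows "(\<Sum>u\<in>Pow T. x ^ card u) = (1 + x) ^ card T"
proof -
  have "(\<Sum>u\<in>Pow T. x ^ card u) = (\<Sum>u\<in>Pow T. \<Prod>i\<in>u. x)"
    by simp
  also have "\<dots> = (\<Prod>i\<in>T. x + 1)"
    using prod_add[OF assms, of "\<lambda>_. x" "\<lambda>_. 1"] by simp
  finally show ?thesis
    by (simp add: add.commute)
qed

text \<open>A Chernoff bound. Symmetric difference with \<open>w0\<close> moves the center to the
  empty set. Weighting a set \<open>u\<close> by \<open>(1 / 4) ^ card u\<close> gives each member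
  of the ball weight at least \<open>2\<close> to the power \<open>- card T / 4\<close>, while all
  subsets together weigh \<open>(5 / 4) ^ card T\<close>, at most
  \<open>exp (card T / 4)\<close>.\<close>

lemma card_hamming_ball_le:
  assumes T: "finite T" and w0: "w0 \<subseteq> T"
  shows "real (card {w \<in> Pow T. 8 * card (sym_diff w w0) < card T}) * exp (real (card T) / 4)
    \<le> 2 ^ card T"
proof -
  let ?m = "card T"
  let ?U = "{u \<in> Pow T. 8 * card u < ?m}"
  have fin: "finite ?U"
    using T by simp
  have "card {w \<in> Pow T. 8 * card (sym_diff w w0) < ?m} \<le> card ?U"
    by (rule card_inj_on_le[where f = "\<lambda>w. sym_diff w w0"]) (use w0 fin in \<open>auto simp: inj_on_def\<close>)
  then have card_le: "real (card {w \<in> Pow T. 8 * card (sym_diff w w0) < ?m}) \<le> real (card ?U)"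
    by simp
  have "real (card ?U) * exp (- (real ?m / 4) * ln 2) = (\<Sum>u\<in>?U. exp (- (real ?m / 4) * ln 2))"
    by simp
  also have "\<dots> \<le> (\<Sum>u\<in>?U. (1 / 4) ^ card u)"
  proof (rule sum_mono)
    fix u assume "u \<in> ?U"
    then have u: "8 * real (card u) \<le> real ?m"
      by auto
    have "- (real ?m / 4) * ln 2 \<le> - (2 * real (card u)) * ln 2"
      using u by (intro mult_right_mono) auto
    then have "exp (- (real ?m / 4) * ln 2) \<le> exp (- (2 * real (card u)) * ln 2)"
      by simp
    also have "\<dots> = exp (real (card u) * (- 2 * ln 2))"
      by (simp add: algebra_simps)
    also have "\<dots> = exp (- 2 * ln 2) ^ card u"
      by (rule exp_of_nat_mult)
    also have "exp (- 2 * ln 2) = (1 / 4 :: real)"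
      by (simp add: exp_minus exp_double field_simps)
    finally show "exp (- (real ?m / 4) * ln 2) \<le> (1 / 4) ^ card u" .
  qed
  also have "\<dots> \<le> (\<Sum>u\<in>Pow T. (1 / 4) ^ card u)"
    using T by (intro sum_mono2) auto
  also have "\<dots> = (1 + 1 / 4) ^ ?m"
    by (rule sum_Pow_power_card[OF T])
  also have "\<dots> \<le> exp (1 / 4) ^ ?m"
    by (intro power_mono exp_ge_add_one_self) auto
  also have "\<dots> = exp (real ?m / 4)"
    by (simp add: exp_of_nat_mult[symmetric])
  finally have U: "real (card ?U) * exp (- (real ?m / 4) * ln 2) \<le> exp (real ?m / 4)" .
  have "real (card ?U) * exp (real ?m / 4) =
      (real (card ?U) * exp (- (real ?m / 4) * ln 2)) * exp (real ?m / 4 + real ?m / 4 * ln 2)"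
    by (simp add: exp_add exp_minus)
  also have "\<dots> \<le> exp (real ?m / 4) * exp (real ?m / 4 + real ?m / 4 * ln 2)"
    using U by (intro mult_right_mono) auto
  also have "\<dots> = exp (real ?m * (1 / 2 + ln 2 / 4))"
    unfolding exp_add[symmetric] by (rule arg_cong[where f = exp]) (simp add: algebra_simps)
  \<comment> \<open>The inequality \<open>1 / 2 + ln 2 / 4 \<le> ln 2\<close> is the same as
    \<open>ln 2 \<ge> 2 / 3\<close>.\<close>
  also have "\<dots> \<le> exp (real ?m * ln 2)"
    using ln2_ge_two_thirds by (simp add: mult_left_mono)
  also have "\<dots> = 2 ^ ?m"
    by (simp add: exp_of_nat_mult)
  finally show ?thesis
    using card_le by (meson exp_ge_zero mult_right_mono order_trans)
qed

section \<open>Frobenius distances and sign matrices\<close>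

lemma frobenius_norm_square:
  assumes "A \<in> carrier_mat d1 d2"
  shows "(frobenius_norm A)\<^sup>2 = (\<Sum>p\<in>{..<d1} \<times> {..<d2}. (A $$ p)\<^sup>2)"
  using assms unfolding frobenius_norm_def
  by (simp add: sum_nonneg sum.cartesian_product)

lemma frobenius_norm_diff_square:
  assumes "A \<in> carrier_mat d1 d2" "B \<in> carrier_mat d1 d2"
  shows "(frobenius_norm (A - B))\<^sup>2 = (\<Sum>p\<in>{..<d1} \<times> {..<d2}. (A $$ p - B $$ p)\<^sup>2)"
proof -
  have "A - B \<in> carrier_mat d1 d2"
    using assms by auto
  then have "(frobenius_norm (A - B))\<^sup>2 = (\<Sum>p\<in>{..<d1} \<times> {..<d2}. ((A - B) $$ p)\<^sup>2)"
    by (rule frobenius_norm_square)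
  also have "\<dots> = (\<Sum>p\<in>{..<d1} \<times> {..<d2}. (A $$ p - B $$ p)\<^sup>2)"
    using assms by (intro sum.cong) auto
  finally show ?thesis .
qed

lemma frobenius_norm_diff_square_le:
  assumes "A \<in> carrier_mat d1 d2" "B \<in> carrier_mat d1 d2" "H \<in> carrier_mat d1 d2"
  shows "(frobenius_norm (A - B))\<^sup>2 \<le> 2 * (frobenius_norm (A - H))\<^sup>2 + 2 * (frobenius_norm (B - H))\<^sup>2"
proof -
  have "(x - y)\<^sup>2 \<le> 2 * (x - h)\<^sup>2 + 2 * (y - h)\<^sup>2" for x y h :: real
    using zero_le_power2[of "(x - h) + (y - h)"] by (simp add: power2_eq_square algebra_simps)
  then show ?thesis
    unfolding frobenius_norm_diff_square[OF assms(1,2)] frobenius_norm_diff_square[OF assms(1,3)]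
      frobenius_norm_diff_square[OF assms(2,3)] sum_distrib_left sum.distrib[symmetric]
    by (intro sum_mono)
qed

text \<open>The map \<open>\<phi>\<close> sends a matrix position to a cell of the repeated pattern.
  A pattern is encoded by the set \<open>w\<close> of its positive cells, so Hamming distance is the
  size of a symmetric difference.\<close>

definition sign_mat :: "nat \<Rightarrow> nat \<Rightarrow> (nat \<times> nat \<Rightarrow> 'c) \<Rightarrow> real \<Rightarrow> 'c set \<Rightarrow> real mat" where
  "sign_mat d1 d2 \<phi> a w = mat d1 d2 (\<lambda>p. if \<phi> p \<in> w then a else - a)"

lemma sign_mat_carrier [simp]: "sign_mat d1 d2 \<phi> a w \<in> carrier_mat d1 d2"
  unfolding sign_mat_def by simp

lemma sign_mat_index:
  "p \<in> {..<d1} \<times> {..<d2} \<Longrightarrow> sign_mat d1 d2 \<phi> a w $$ p = (if \<phi> p \<in> w then a else - a)"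
  unfolding sign_mat_def by auto

lemma sign_mat_index_square:
  "p \<in> {..<d1} \<times> {..<d2} \<Longrightarrow> (sign_mat d1 d2 \<phi> a w $$ p)\<^sup>2 = a\<^sup>2"
  by (simp add: sign_mat_index)

lemma frobenius_norm_sign_mat:
  assumes "0 \<le> a"
  shows "frobenius_norm (sign_mat d1 d2 \<phi> a w) = a * sqrt (real d1 * real d2)"
proof (rule power2_eq_imp_eq)
  show "(frobenius_norm (sign_mat d1 d2 \<phi> a w))\<^sup>2 = (a * sqrt (real d1 * real d2))\<^sup>2"
    by (subst frobenius_norm_square[OF sign_mat_carrier])
       (simp add: sign_mat_index_square power_mult_distrib)
qed (use assms in \<open>auto simp: frobenius_norm_def intro!: sum_nonneg\<close>)

lemma sign_mat_in_K_set:
  assumes d: "d1 > 0" "d2 > 0" and a: "0 \<le> a" "a \<le> \<alpha>"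
    and b: "real b * a\<^sup>2 \<le> \<alpha>\<^sup>2 * r"
    and P: "P \<in> carrier_mat d1 b" and Q: "Q \<in> carrier_mat b d2"
    and eq: "sign_mat d1 d2 \<phi> a w = P * Q"
  shows "sign_mat d1 d2 \<phi> a w \<in> K_set d1 d2 \<alpha> r"
proof -
  let ?M = "sign_mat d1 d2 \<phi> a w"
  have "nuclear_norm ?M \<le> sqrt (real b) * (a * sqrt (real d1 * real d2))"
    using nuclear_norm_mult_le[OF P Q] unfolding eq[symmetric] frobenius_norm_sign_mat[OF a(1)] .
  also have "\<dots> = sqrt (real b * a\<^sup>2) * sqrt (real d1 * real d2)"
    using a(1) by (simp add: real_sqrt_mult)
  also have "\<dots> \<le> sqrt (\<alpha>\<^sup>2 * r) * sqrt (real d1 * real d2)"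
    using b by (intro mult_right_mono real_sqrt_le_mono) auto
  also have "\<dots> = \<alpha> * sqrt (r * real d1 * real d2)"
    using a by (simp add: real_sqrt_mult)
  finally have "nuclear_norm ?M \<le> \<alpha> * sqrt (r * real d1 * real d2)" .
  moreover have "max_norm ?M \<le> \<alpha>"
  proof -
    let ?X = "{\<bar>?M $$ (i, j)\<bar> | i j. i < dim_row ?M \<and> j < dim_col ?M}"
    have dims: "dim_row ?M = d1" "dim_col ?M = d2"
      using sign_mat_carrier by blast+
    have X: "?X = (\<lambda>p. \<bar>?M $$ p\<bar>) ` ({..<d1} \<times> {..<d2})"
      unfolding dims by (auto simp: image_iff)
    have "finite ?X" "?X \<noteq> {}"
      unfolding X using d by auto
    moreover have "x \<le> \<alpha>" if "x \<in> ?X" for x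
    proof -
      from that obtain i j where "i < d1" "j < d2" "x = \<bar>?M $$ (i, j)\<bar>"
        unfolding dims by blast
      then show ?thesis
        using a by (auto simp: sign_mat_index)
    qed
    ultimately show ?thesis
      unfolding max_norm_def by (metis (no_types, lifting) Max_in)
  qed
  ultimately show ?thesis
    unfolding K_set_def by simp
qed

text \<open>Each cell in which the patterns differ fills at least \<open>d / (2 * b)\<close>
  positions, each adding \<open>4 * a\<^sup>2\<close> to the squared distance. Two matrices close to
  the same \<open>H\<close> have squared distance below \<open>4 * \<delta>\<close>.\<close>

lemma sign_mat_separated:
  fixes \<phi> :: "nat \<times> nat \<Rightarrow> 'c"
  assumes T: "finite T" "w \<subseteq> T" "w' \<subseteq> T"
    and fiber: "\<And>c. c \<in> T \<Longrightarrow> d \<le> 2 * b * card {p \<in> {..<d1} \<times> {..<d2}. \<phi> p = c}"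
    and b: "b > 0" and H: "H \<in> carrier_mat d1 d2"
    and w: "(frobenius_norm (sign_mat d1 d2 \<phi> a w - H))\<^sup>2 < \<delta>"
    and w': "(frobenius_norm (sign_mat d1 d2 \<phi> a w' - H))\<^sup>2 < \<delta>"
  shows "a\<^sup>2 * real d * real (card (sym_diff w w')) < 2 * real b * \<delta>"
proof -
  let ?I = "{..<d1} \<times> {..<d2}" and ?D = "sym_diff w w'"
  have D: "finite ?D" "?D \<subseteq> T"
    using T(2,3) finite_subset[OF T(2,1)] finite_subset[OF T(3,1)] by auto
  have fib: "real d \<le> 2 * real b * real (card {p \<in> ?I. \<phi> p = c})" if "c \<in> ?D" for c
  proof -
    have "real d \<le> real (2 * b * card {p \<in> ?I. \<phi> p = c})"
      using fiber[OF subsetD[OF D(2) that]] by (rule of_nat_mono)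
    then show ?thesis
      by simp
  qed
  have entry: "(if \<phi> p \<in> ?D then 4 * a\<^sup>2 else 0) =
      (sign_mat d1 d2 \<phi> a w $$ p - sign_mat d1 d2 \<phi> a w' $$ p)\<^sup>2" if p: "p \<in> ?I" for p
    unfolding sign_mat_index[OF p] by (auto simp: power2_eq_square)
  have "a\<^sup>2 * real d * real (card ?D) = a\<^sup>2 * (\<Sum>c\<in>?D. real d)"
    by simp
  also have "\<dots> \<le> a\<^sup>2 * (\<Sum>c\<in>?D. 2 * real b * real (card {p \<in> ?I. \<phi> p = c}))"
    by (intro mult_left_mono sum_mono fib) auto
  also have "\<dots> = real b / 2 * (4 * a\<^sup>2 * real (\<Sum>c\<in>?D. card {p \<in> ?I. \<phi> p = c}))"
    by (simp add: sum_distrib_left[symmetric])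
  also have "(\<Sum>c\<in>?D. card {p \<in> ?I. \<phi> p = c}) = card (\<Union>c\<in>?D. {p \<in> ?I. \<phi> p = c})"
    using D by (intro card_UN_disjoint[symmetric]) auto
  also have "(\<Union>c\<in>?D. {p \<in> ?I. \<phi> p = c}) = {p \<in> ?I. \<phi> p \<in> ?D}"
    by auto
  also have "4 * a\<^sup>2 * real (card {p \<in> ?I. \<phi> p \<in> ?D}) = (\<Sum>p\<in>?I. if \<phi> p \<in> ?D then 4 * a\<^sup>2 else 0)"
    by (simp add: sum.If_cases Int_def)
  also have "\<dots> = (frobenius_norm (sign_mat d1 d2 \<phi> a w - sign_mat d1 d2 \<phi> a w'))\<^sup>2"
    unfolding frobenius_norm_diff_square[OF sign_mat_carrier sign_mat_carrier]
    by (rule sum.cong[OF refl]) (rule entry)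
  finally have "a\<^sup>2 * real d * real (card ?D) \<le>
      real b / 2 * (frobenius_norm (sign_mat d1 d2 \<phi> a w - sign_mat d1 d2 \<phi> a w'))\<^sup>2" .
  also have "\<dots> < real b / 2 * (4 * \<delta>)"
  proof (rule mult_strict_left_mono)
    show "(frobenius_norm (sign_mat d1 d2 \<phi> a w - sign_mat d1 d2 \<phi> a w'))\<^sup>2 < 4 * \<delta>"
      using frobenius_norm_diff_square_le[OF sign_mat_carrier sign_mat_carrier H, of \<phi> a w \<phi> a w'] w w'
      by linarith
  qed (use b in simp)
  finally show ?thesis
    by (simp add: mult_ac)
qed

section \<open>Residue classes and tilings of low rank\<close>

lemma le_two_mult_mult_div:
  fixes b d :: nat
  assumes "0 < b" "b \<le> d"
  shows "d \<le> 2 * b * (d div b)"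
proof -
  have "d < b * (d div b) + b"
    using mod_less_divisor[OF assms(1), of d] mult_div_mod_eq[of b d] by linarith
  moreover have "b * 1 \<le> b * (d div b)"
    using assms by (intro mult_left_mono) (auto simp: Suc_le_eq div_greater_zero_iff)
  ultimately show ?thesis
    by linarith
qed

lemma card_mod_fiber:
  fixes b d :: nat
  assumes "k < b"
  shows "d div b \<le> card {i \<in> {..<d}. i mod b = k}"
proof -
  have "q * b + k < d" if "q < d div b" for q
  proof -
    have "q * b + k < (q + 1) * b"
      using assms by simp
    also have "\<dots> \<le> (d div b) * b"
      using that by (intro mult_right_mono) auto
    finally show ?thesis
      using div_times_less_eq_dividend[of d b] by linarith
  qed
  then have "card {..<d div b} \<le> card {i \<in> {..<d}. i mod b = k}"
    using assms by (intro card_inj_on_le[where f = "\<lambda>q. q * b + k"]) (auto simp: inj_on_def)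
  then show ?thesis
    by simp
qed

text \<open>Reducing the coordinate along the smaller dimension modulo \<open>b\<close> uses every
  cell about equally often; for \<open>b\<close> at most that dimension, rounding costs a factor of
  at most 2. The matrix then has only \<open>b\<close> distinct rows or columns and factors through
  dimension \<open>b\<close>.\<close>

lemma low_rank_tiling:
  assumes b: "0 < b" "b \<le> min d1 d2"
  obtains \<phi> :: "nat \<times> nat \<Rightarrow> nat \<times> nat" where
    "\<And>c. c \<in> {..<b} \<times> {..<max d1 d2} \<Longrightarrow> min d1 d2 \<le> 2 * b * card {p \<in> {..<d1} \<times> {..<d2}. \<phi> p = c}"
    "\<And>a w. \<exists>P \<in> carrier_mat d1 b. \<exists>Q \<in> carrier_mat b d2. sign_mat d1 d2 \<phi> a w = P * Q"
proof (cases "d1 \<le> d2")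
  case True
  let ?\<phi> = "\<lambda>(i, j). (i mod b, j)"
  show thesis
  proof (rule that[of ?\<phi>])
    fix c assume "c \<in> {..<b} \<times> {..<max d1 d2}"
    then obtain k l where c: "c = (k, l)" "k < b" "l < d2"
      using True by auto
    have "{p \<in> {..<d1} \<times> {..<d2}. ?\<phi> p = c} = {i \<in> {..<d1}. i mod b = k} \<times> {l}"
      using c by auto
    then have "d1 div b \<le> card {p \<in> {..<d1} \<times> {..<d2}. ?\<phi> p = c}"
      using card_mod_fiber[OF c(2)] by (simp add: card_cartesian_product)
    then have "2 * b * (d1 div b) \<le> 2 * b * card {p \<in> {..<d1} \<times> {..<d2}. ?\<phi> p = c}"
      by simp
    then show "min d1 d2 \<le> 2 * b * card {p \<in> {..<d1} \<times> {..<d2}. ?\<phi> p = c}"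
      using le_two_mult_mult_div[of b d1] b True by linarith
  next
    fix a :: real and w
    \<comment> \<open>A 0/1 selection matrix: row \<open>i\<close> of the product is row
      \<open>i mod b\<close> of the pattern.\<close>
    let ?P = "mat d1 b (\<lambda>(i, k). of_bool (i mod b = k))"
    let ?Q = "mat b d2 (\<lambda>c. if c \<in> w then a else - a)"
    have "sign_mat d1 d2 ?\<phi> a w = ?P * ?Q"
    proof (rule eq_matI)
      fix i j assume "i < dim_row (?P * ?Q)" "j < dim_col (?P * ?Q)"
      then have ij: "i < d1" "j < d2"
        by auto
      have "(?P * ?Q) $$ (i, j) = (\<Sum>k<b. if k = i mod b then (if (k, j) \<in> w then a else - a) else 0)"
        using ij by (auto simp: scalar_prod_def lessThan_atLeast0 intro!: sum.cong)
      then show "sign_mat d1 d2 ?\<phi> a w $$ (i, j) = (?P * ?Q) $$ (i, j)"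
        using ij b by (simp add: sign_mat_index)
    qed (auto simp: sign_mat_def)
    then show "\<exists>P \<in> carrier_mat d1 b. \<exists>Q \<in> carrier_mat b d2. sign_mat d1 d2 ?\<phi> a w = P * Q"
      by (intro bexI[of _ ?P] bexI[of _ ?Q]) auto
  qed
next
  case False
  let ?\<phi> = "\<lambda>(i, j). (j mod b, i)"
  show thesis
  proof (rule that[of ?\<phi>])
    fix c assume "c \<in> {..<b} \<times> {..<max d1 d2}"
    then obtain k l where c: "c = (k, l)" "k < b" "l < d1"
      using False by auto
    have "{p \<in> {..<d1} \<times> {..<d2}. ?\<phi> p = c} = {l} \<times> {j \<in> {..<d2}. j mod b = k}"
      using c by auto
    then have "d2 div b \<le> card {p \<in> {..<d1} \<times> {..<d2}. ?\<phi> p = c}"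
      using card_mod_fiber[OF c(2)] by (simp add: card_cartesian_product)
    then have "2 * b * (d2 div b) \<le> 2 * b * card {p \<in> {..<d1} \<times> {..<d2}. ?\<phi> p = c}"
      by simp
    then show "min d1 d2 \<le> 2 * b * card {p \<in> {..<d1} \<times> {..<d2}. ?\<phi> p = c}"
      using le_two_mult_mult_div[of b d2] b False by linarith
  next
    fix a :: real and w
    \<comment> \<open>Cells always list the residue first, so here the pattern enters transposed and
      the selection matrix stands on the right.\<close>
    let ?P = "mat d1 b (\<lambda>(i, k). if (k, i) \<in> w then a else - a)"
    let ?Q = "mat b d2 (\<lambda>(k, j). of_bool (j mod b = k))"
    have "sign_mat d1 d2 ?\<phi> a w = ?P * ?Q"
    proof (rule eq_matI)
      fix i j assume "i < dim_row (?P * ?Q)" "j < dim_col (?P * ?Q)"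
      then have ij: "i < d1" "j < d2"
        by auto
      have "(?P * ?Q) $$ (i, j) = (\<Sum>k<b. if k = j mod b then (if (k, i) \<in> w then a else - a) else 0)"
        using ij by (auto simp: scalar_prod_def lessThan_atLeast0 intro!: sum.cong)
      then show "sign_mat d1 d2 ?\<phi> a w $$ (i, j) = (?P * ?Q) $$ (i, j)"
        using ij b by (simp add: sign_mat_index)
    qed (auto simp: sign_mat_def)
    then show "\<exists>P \<in> carrier_mat d1 b. \<exists>Q \<in> carrier_mat b d2. sign_mat d1 d2 ?\<phi> a w = P * Q"
      by (intro bexI[of _ ?P] bexI[of _ ?Q]) auto
  qed
qed

subsection \<open>The lower bound\<close>

lemma sets_gaussian_noise: "sets (gaussian_noise d1 d2 \<sigma>) = sets (PiM ({..<d1} \<times> {..<d2}) (\<lambda>_. borel))"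
  unfolding gaussian_noise_def by (intro sets_PiM_cong) auto

lemma space_gaussian_noise: "space (gaussian_noise d1 d2 \<sigma>) = PiE ({..<d1} \<times> {..<d2}) (\<lambda>_. UNIV)"
  unfolding gaussian_noise_def by (simp add: space_PiM)

lemma squared_error_measurable:
  assumes \<Omega>: "\<Omega> \<subseteq> {..<d1} \<times> {..<d2}" and alg: "matrix_algorithm d1 d2 \<Omega> S Mhat"
    and M: "M \<in> carrier_mat d1 d2"
  shows "(\<lambda>p. (frobenius_norm (M - Mhat (restrict (fst p) \<Omega>) (snd p)))\<^sup>2)
    \<in> borel_measurable (gaussian_noise d1 d2 \<sigma> \<Otimes>\<^sub>M S)"
proof -
  let ?I = "{..<d1} \<times> {..<d2}" and ?N = "gaussian_noise d1 d2 \<sigma>"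
  have "(\<lambda>Z. restrict Z \<Omega>) \<in> measurable ?N (PiM \<Omega> (\<lambda>_. borel))"
    unfolding measurable_cong_sets[OF sets_gaussian_noise refl] by (rule measurable_restrict_subset[OF \<Omega>])
  then have obs: "(\<lambda>p. (restrict (fst p) \<Omega>, snd p)) \<in> measurable (?N \<Otimes>\<^sub>M S) (PiM \<Omega> (\<lambda>_. borel) \<Otimes>\<^sub>M S)"
    by measurable
  have entry: "(\<lambda>p. Mhat (restrict (fst p) \<Omega>) (snd p) $$ q) \<in> borel_measurable (?N \<Otimes>\<^sub>M S)"
    if "q \<in> ?I" for q
  proof -
    from that alg have "(\<lambda>(y, s). Mhat y s $$ q) \<in> borel_measurable (PiM \<Omega> (\<lambda>_. borel) \<Otimes>\<^sub>M S)"
      unfolding matrix_algorithm_def by auto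
    from measurable_compose[OF obs this] show ?thesis
      by simp
  qed
  have "(\<lambda>p. \<Sum>q\<in>?I. (M $$ q - Mhat (restrict (fst p) \<Omega>) (snd p) $$ q)\<^sup>2) \<in> borel_measurable (?N \<Otimes>\<^sub>M S)"
    using entry by (intro borel_measurable_sum borel_measurable_power borel_measurable_diff) auto
  \<comment> \<open>The entrywise formula agrees with the norm only on the space, where the estimate
    is known to have the right dimensions.\<close>
  also have "?this \<longleftrightarrow> ?thesis"
  proof (rule measurable_cong)
    fix p assume "p \<in> space (?N \<Otimes>\<^sub>M S)"
    then have "Mhat (restrict (fst p) \<Omega>) (snd p) \<in> carrier_mat d1 d2"
      using alg unfolding matrix_algorithm_def by (auto simp: space_pair_measure space_PiM)
    then show "(\<Sum>q\<in>?I. (M $$ q - Mhat (restrict (fst p) \<Omega>) (snd p) $$ q)\<^sup>2) =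
        (frobenius_norm (M - Mhat (restrict (fst p) \<Omega>) (snd p)))\<^sup>2"
      by (rule frobenius_norm_diff_square[OF M, symmetric])
  qed
  finally show ?thesis .
qed

lemma minimax_lower_bound:
  fixes \<alpha> r \<sigma> \<epsilon> :: real
  assumes d: "d1 > 0" "d2 > 0" and \<alpha>: "\<alpha> \<ge> 1" and r: "r \<ge> 1" and \<sigma>: "\<sigma> > 0"
    and \<Omega>: "\<Omega> \<subseteq> {..<d1} \<times> {..<d2}" and S: "prob_space S"
    and alg: "matrix_algorithm d1 d2 \<Omega> S Mhat"
    and \<epsilon>: "0 < \<epsilon>" "\<epsilon> \<le> 1 / 1024" "r * \<alpha>\<^sup>2 / real (min d1 d2) < \<epsilon>"
    and noise: "4096 * real (card \<Omega>) * \<epsilon>\<^sup>2 \<le> \<alpha>\<^sup>2 * \<sigma>\<^sup>2 * r * real (max d1 d2)"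
  shows "\<exists>M \<in> K_set d1 d2 \<alpha> r.
    \<P>((Z, s) in gaussian_noise d1 d2 \<sigma> \<Otimes>\<^sub>M S.
      1 / (real d1 * real d2) * (frobenius_norm (M - Mhat (observe \<Omega> M Z) s))\<^sup>2 \<ge> \<epsilon>) \<ge> 3 / 4"
proof -
  let ?I = "{..<d1} \<times> {..<d2}" and ?N = "gaussian_noise d1 d2 \<sigma>"
  let ?P = "?N \<Otimes>\<^sub>M S"
  define d D where "d = min d1 d2" and "D = max d1 d2"
  have dD: "0 < d" "0 < D" "real d1 * real d2 = real d * real D"
    using assms(1,2) unfolding d_def D_def by (auto simp: min_def max_def)
  \<comment> \<open>The factor 4 makes \<open>a\<^sup>2 = 16 * \<epsilon>\<close>, which turns the
    separation bound into exactly the radius \<open>card T / 8\<close> of the Hamming ball.\<close>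
  define a where "a = 4 * sqrt \<epsilon>"
  have a: "0 \<le> a" "a\<^sup>2 = 16 * \<epsilon>"
    using \<epsilon> by (auto simp: a_def power_mult_distrib)
  have \<alpha>2: "1 \<le> \<alpha>\<^sup>2"
    using \<alpha> by simp
  have a_le: "a \<le> \<alpha>"
  proof (rule power2_le_imp_le)
    show "a\<^sup>2 \<le> \<alpha>\<^sup>2"
      using \<alpha>2 \<epsilon>(2) a(2) by linarith
  qed (use \<alpha> in simp)
  have r\<alpha>: "1 \<le> r * \<alpha>\<^sup>2"
    using mult_mono[OF r \<alpha>2] r by simp
  define x where "x = r * \<alpha>\<^sup>2 / (16 * \<epsilon>)"
  have x1: "1 \<le> x"
    using r\<alpha> \<epsilon> by (simp add: x_def field_simps)
  \<comment> \<open>The largest integer with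
    \<open>b * a\<^sup>2 \<le> r * \<alpha>\<^sup>2\<close>, the nuclear norm budget. As
    \<open>x \<ge> 1\<close>, rounding down loses less than a factor of 2.\<close>
  define b where "b = nat \<lfloor>x\<rfloor>"
  have b_x: "real b \<le> x" "x < real b + 1"
    using x1 unfolding b_def by auto
  have b: "0 < b"
    using x1 unfolding b_def by simp
  have b_upper: "real b * a\<^sup>2 \<le> \<alpha>\<^sup>2 * r"
    using b_x(1) \<epsilon>(1) by (simp add: x_def a field_simps)
  have "x < 2 * real b"
    using b_x b by linarith
  then have b_lower: "r * \<alpha>\<^sup>2 \<le> 32 * \<epsilon> * real b"
    using \<epsilon>(1) by (simp add: x_def field_simps)
  \<comment> \<open>The gap hypothesis enters here: it keeps the pattern height \<open>b\<close>
    below the smaller dimension.\<close>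
  have "r * \<alpha>\<^sup>2 < \<epsilon> * real d"
    using \<epsilon>(3) dD(1) by (simp add: d_def field_simps)
  moreover have "0 < \<epsilon> * real d"
    using \<epsilon>(1) dD(1) by simp
  ultimately have "r * \<alpha>\<^sup>2 < 16 * (\<epsilon> * real d)"
    by linarith
  then have "x < real d"
    using \<epsilon>(1) by (simp add: x_def field_simps)
  then have b_d: "b \<le> d"
    using b_x(1) by linarith
  define T where "T = {..<b} \<times> {..<D}"
  have T: "finite T" "card T = b * D"
    unfolding T_def by auto
  from low_rank_tiling[OF b b_d[unfolded d_def]] obtain \<phi> :: "nat \<times> nat \<Rightarrow> nat \<times> nat"
    where fiber: "\<And>c. c \<in> T \<Longrightarrow> d \<le> 2 * b * card {p \<in> ?I. \<phi> p = c}"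
      and factor: "\<And>a w. \<exists>P \<in> carrier_mat d1 b. \<exists>Q \<in> carrier_mat b d2. sign_mat d1 d2 \<phi> a w = P * Q"
    unfolding T_def d_def D_def by blast
  define M where "M = sign_mat d1 d2 \<phi> a"
  have M_carrier: "M w \<in> carrier_mat d1 d2" for w
    unfolding M_def by simp
  have M_K: "M w \<in> K_set d1 d2 \<alpha> r" for w
    using factor[of a w] sign_mat_in_K_set[OF d a(1) a_le b_upper] unfolding M_def by blast
  let ?H = "\<lambda>p. Mhat (restrict (fst p) \<Omega>) (snd p)"
  have H_carrier: "?H p \<in> carrier_mat d1 d2" if "p \<in> space ?P" for p
    using that alg unfolding matrix_algorithm_def by (auto simp: space_pair_measure space_PiM)
  \<comment> \<open>The event that the algorithm, fed with the point itself as data, lands close to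
    \<open>M w\<close>. The signal is added only later, as a shift of the noise.\<close>
  define G where "G w = {p \<in> space ?P. (frobenius_norm (M w - ?H p))\<^sup>2 < \<epsilon> * (real d1 * real d2)}" for w
  have G_meas: "G w \<in> sets ?P" for w
    unfolding G_def using squared_error_measurable[OF \<Omega> alg M_carrier] by measurable
  \<comment> \<open>Shifting only the observed positions leaves the data unchanged and limits the
    energy to \<open>card \<Omega>\<close> entries.\<close>
  define m where "m w q = (if q \<in> \<Omega> then M w $$ q else 0)" for w q
  define A where "A = real (card \<Omega>) * (16 * \<epsilon>) / \<sigma>\<^sup>2"
  define V where "V = 2 ^ card T / exp (real (card T) / 4)"
  have "\<exists>w\<in>Pow T. measure ?P {p \<in> space ?P. ((\<lambda>i\<in>?I. m w i + fst p i), snd p) \<in> G w} \<le> 1 / 4"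
  proof (rule gaussian_testing[where I = ?I and \<sigma> = \<sigma> and S = S,
        folded gaussian_noise_def[of d1 d2 \<sigma>], OF _ \<sigma> S])
    show "real (card {w \<in> Pow T. p \<in> G w}) \<le> V" if p: "p \<in> space ?P" for p
    proof (cases "{w \<in> Pow T. p \<in> G w} = {}")
      case True
      then show ?thesis
        unfolding V_def True by simp
    next
      case False
      \<comment> \<open>Any one pattern compatible with the estimate serves as center for all the
        others.\<close>
      then obtain w0 where w0: "w0 \<subseteq> T" "p \<in> G w0"
        by auto
      have "{w \<in> Pow T. p \<in> G w} \<subseteq> {w \<in> Pow T. 8 * card (sym_diff w w0) < card T}"
      proof
        fix w assume w: "w \<in> {w \<in> Pow T. p \<in> G w}"
        let ?k = "real (card (sym_diff w w0))"
        have "a\<^sup>2 * real d * ?k < 2 * real b * (\<epsilon> * (real d1 * real d2))"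
          using w w0 unfolding G_def M_def
          by (intro sign_mat_separated[OF T(1) _ _ fiber b H_carrier[OF p]]) auto
        then have "(2 * \<epsilon> * real d) * (8 * ?k) < (2 * \<epsilon> * real d) * (real b * real D)"
          unfolding a(2) dD(3) by (simp add: mult_ac)
        then have "8 * ?k < real b * real D"
          using \<epsilon>(1) dD(1) by (simp add: mult_less_cancel_left mult.commute)
        then have "real (8 * card (sym_diff w w0)) < real (card T)"
          unfolding T(2) by simp
        then show "w \<in> {w \<in> Pow T. 8 * card (sym_diff w w0) < card T}"
          using w by (simp only: of_nat_less_iff mem_Collect_eq)
      qed
      then have "card {w \<in> Pow T. p \<in> G w} \<le> card {w \<in> Pow T. 8 * card (sym_diff w w0) < card T}"
        using T(1) by (intro card_mono) auto
      also have "real \<dots> \<le> V"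
        using card_hamming_ball_le[OF T(1) w0(1)] unfolding V_def by (simp add: field_simps)
      finally show ?thesis
        by simp
    qed
    show "(\<Sum>i\<in>?I. (m w i)\<^sup>2) / \<sigma>\<^sup>2 \<le> A" for w
    proof -
      have "(\<Sum>i\<in>?I. (m w i)\<^sup>2) = (\<Sum>i\<in>?I. if i \<in> \<Omega> then a\<^sup>2 else 0)"
        by (rule sum.cong[OF refl]) (simp add: m_def M_def sign_mat_index_square)
      also have "\<dots> = real (card \<Omega>) * (16 * \<epsilon>)"
        using \<Omega> by (simp add: sum.inter_restrict[symmetric] Int_absorb1 a)
      finally show ?thesis
        unfolding A_def by simp
    qed
    show "16 * exp A * V \<le> real (card (Pow T))"
    proof -
      let ?m = "real b * real D"
      have m_ge: "r * \<alpha>\<^sup>2 * real D \<le> 32 * \<epsilon> * ?m"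
        using mult_right_mono[OF b_lower, of "real D"] by (simp add: mult_ac)
      have "1 \<le> r * \<alpha>\<^sup>2 * real D"
        using mult_mono[OF r\<alpha>, of 1 "real D"] dD(2) r\<alpha> by simp
      then have "1 \<le> 32 * \<epsilon> * ?m"
        using m_ge by linarith
      also have "\<dots> \<le> 32 * (1 / 1024) * ?m"
        using \<epsilon>(2) by (intro mult_right_mono mult_left_mono) auto
      \<comment> \<open>The bound \<open>\<epsilon> \<le> 1 / 1024\<close> forces
        \<open>b * D \<ge> 32\<close>. One half of the exponent \<open>b * D / 4\<close> then
        absorbs the factor 16, and the other half absorbs \<open>exp A\<close>.\<close>
      finally have m32: "4 \<le> ?m / 8"
        by simp
      \<comment> \<open>The constant 4096 is 16 * 256: the 16 comes from \<open>a\<^sup>2\<close>,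
        and 256 = 8 * 32 combines the target \<open>?m / 8\<close> with the rounding bound
        \<open>b_lower\<close>.\<close>
      have "(16 * real (card \<Omega>) * \<epsilon>) * (256 * \<epsilon>) = 4096 * real (card \<Omega>) * \<epsilon>\<^sup>2"
        by (simp add: power2_eq_square)
      also have "\<dots> \<le> \<sigma>\<^sup>2 * (r * \<alpha>\<^sup>2 * real D)"
        using noise by (simp add: D_def mult_ac)
      also have "\<dots> \<le> \<sigma>\<^sup>2 * (32 * \<epsilon> * ?m)"
        by (rule mult_left_mono[OF m_ge]) simp
      also have "\<dots> = (\<sigma>\<^sup>2 * (?m / 8)) * (256 * \<epsilon>)"
        by simp
      finally have "16 * real (card \<Omega>) * \<epsilon> \<le> \<sigma>\<^sup>2 * (?m / 8)"
        by (rule mult_right_le_imp_le) (use \<epsilon>(1) in simp)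
      then have A_le: "A \<le> ?m / 8"
        unfolding A_def using \<sigma> by (simp add: field_simps)
      have "(16 :: real) = 2 ^ 4"
        by simp
      also have "\<dots> \<le> exp 1 ^ 4"
        using exp_ge_add_one_self[of 1] by (intro power_mono) auto
      also have "\<dots> = exp (4 :: real)"
        by (simp add: exp_of_nat_mult[symmetric])
      also have "\<dots> \<le> exp (?m / 8)"
        using m32 by simp
      finally have "16 * exp A \<le> exp (?m / 8) * exp (?m / 8)"
        using A_le by (intro mult_mono) auto
      also have "\<dots> = exp (real (card T) / 4)"
        unfolding T(2) exp_add[symmetric] by simp
      finally have "16 * exp A * V \<le> exp (real (card T) / 4) * V"
        by (intro mult_right_mono) (auto simp: V_def)
      also have "\<dots> = real (card (Pow T))"
        using T(1) by (simp add: V_def card_Pow)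
      finally show ?thesis .
    qed
  qed (use T(1) G_meas in auto)
  then obtain w where w: "measure ?P {p \<in> space ?P. ((\<lambda>i\<in>?I. m w i + fst p i), snd p) \<in> G w} \<le> 1 / 4"
    by blast
  let ?E = "{p \<in> space ?P. ((\<lambda>i\<in>?I. m w i + fst p i), snd p) \<in> G w}"
  interpret S: prob_space S by fact
  interpret N: prob_space ?N
    unfolding gaussian_noise_def by (intro prob_space_PiM prob_space_centered_gaussian \<sigma>)
  interpret P: pair_prob_space ?N S ..
  have shift [measurable]: "(\<lambda>Z. \<lambda>i\<in>?I. m w i + Z i) \<in> measurable ?N ?N"
    unfolding measurable_cong_sets[OF sets_gaussian_noise sets_gaussian_noise] by measurable
  have [measurable]: "G w \<in> sets ?P"
    by (rule G_meas)
  have E: "?E \<in> sets ?P"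
    by measurable
  \<comment> \<open>Restricted to \<open>\<Omega>\<close>, the shifted noise is exactly the
    observation of \<open>M w\<close>, so \<open>?E\<close> is the event of a small error under the
    true model.\<close>
  have obs: "restrict (\<lambda>i\<in>?I. m w i + Z i) \<Omega> = observe \<Omega> (M w) Z" for Z
    using \<Omega> unfolding observe_def m_def by (auto simp: fun_eq_iff)
  have "3 / 4 \<le> P.prob (space ?P - ?E)"
    using w P.prob_compl[OF E] by simp
  also have "space ?P - ?E = {p \<in> space ?P. case p of (Z, s) \<Rightarrow>
      1 / (real d1 * real d2) * (frobenius_norm (M w - Mhat (observe \<Omega> (M w) Z) s))\<^sup>2 \<ge> \<epsilon>}"
  proof -
    have "p \<notin> ?E \<longleftrightarrow> (case p of (Z, s) \<Rightarrow>
        1 / (real d1 * real d2) * (frobenius_norm (M w - Mhat (observe \<Omega> (M w) Z) s))\<^sup>2 \<ge> \<epsilon>)"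
      if p: "p \<in> space ?P" for p
    proof -
      obtain Z s where Zs: "p = (Z, s)"
        by (cases p)
      have "((\<lambda>i\<in>?I. m w i + fst p i), snd p) \<in> space ?P"
        using p by (auto simp: space_pair_measure space_gaussian_noise)
      then have "p \<in> ?E \<longleftrightarrow> (frobenius_norm (M w - Mhat (observe \<Omega> (M w) Z) s))\<^sup>2 < \<epsilon> * (real d1 * real d2)"
        using p unfolding Zs G_def mem_Collect_eq fst_conv snd_conv obs by blast
      moreover have "0 < real d1 * real d2"
        using d by simp
      ultimately show ?thesis
        unfolding Zs by (simp add: not_less field_simps)
    qed
    then show ?thesis
      by blast
  qed
  also have "\<dots> = {(Z, s). (Z, s) \<in> space ?P \<and>
      1 / (real d1 * real d2) * (frobenius_norm (M w - Mhat (observe \<Omega> (M w) Z) s))\<^sup>2 \<ge> \<epsilon>}"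
    by auto
  finally show ?thesis
    using M_K by (rule bexI[where x = "M w"])
qed

theorem theorem4:
  shows "\<exists>C0 C1 C2 :: real. C0 > 0 \<and> C1 > 0 \<and> C2 > 0 \<and>
    (\<forall>(d1 :: nat) (d2 :: nat) (\<alpha> :: real) (r :: real) (\<sigma> :: real) (\<Omega> :: (nat \<times> nat) set) (n :: nat)
        (S :: real measure) (Mhat :: (nat \<times> nat \<Rightarrow> real) \<Rightarrow> real \<Rightarrow> real mat).
      d1 > 0 \<longrightarrow> d2 > 0 \<longrightarrow> \<alpha> \<ge> 1 \<longrightarrow> r \<ge> 1 \<longrightarrow>
      \<alpha>\<^sup>2 * r * real (max d1 d2) \<ge> C0 \<longrightarrow>
      \<sigma> > 0 \<longrightarrow>
      \<Omega> \<subseteq> {..<d1} \<times> {..<d2} \<longrightarrow> card \<Omega> = n \<longrightarrow>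
      prob_space S \<longrightarrow> sets S = sets borel \<longrightarrow>
      matrix_algorithm d1 d2 \<Omega> S Mhat \<longrightarrow>
      min C1 (C2 * \<alpha> * \<sigma> * sqrt (r * real (max d1 d2) / real n)) > r * \<alpha>\<^sup>2 / real (min d1 d2) \<longrightarrow>
      (\<exists>M \<in> K_set d1 d2 \<alpha> r.
        \<P>((Z, s) in gaussian_noise d1 d2 \<sigma> \<Otimes>\<^sub>M S.
            1 / (real d1 * real d2) * (frobenius_norm (M - Mhat (observe \<Omega> M Z) s))\<^sup>2
              \<ge> min C1 (C2 * \<alpha> * \<sigma> * sqrt (r * real (max d1 d2) / real n))) \<ge> 3 / 4))"
\<comment> \<open>The value 1/64 is the square root of 1/4096, matching the noise condition of the
  minimax bound; 1/1024 is its cap on the error.\<close>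
proof (rule exI[of _ 1], rule exI[of _ "1 / 1024"], rule exI[of _ "1 / 64"], intro conjI allI impI)
  fix d1 d2 n :: nat and \<alpha> r \<sigma> :: real and \<Omega> :: "(nat \<times> nat) set" and S :: "real measure"
    and Mhat :: "(nat \<times> nat \<Rightarrow> real) \<Rightarrow> real \<Rightarrow> real mat"
  let ?\<epsilon> = "min (1 / 1024) (1 / 64 * \<alpha> * \<sigma> * sqrt (r * real (max d1 d2) / real n))"
  assume d: "d1 > 0" "d2 > 0" and \<alpha>: "\<alpha> \<ge> 1" and r: "r \<ge> 1" and \<sigma>: "\<sigma> > 0"
    and \<Omega>: "\<Omega> \<subseteq> {..<d1} \<times> {..<d2}" and n: "card \<Omega> = n"
    and S: "prob_space S" and alg: "matrix_algorithm d1 d2 \<Omega> S Mhat"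
    and gap: "?\<epsilon> > r * \<alpha>\<^sup>2 / real (min d1 d2)"
  have "0 \<le> r * \<alpha>\<^sup>2 / real (min d1 d2)"
    using r by simp
  then have pos: "0 < ?\<epsilon>"
    using gap by linarith
  have "4096 * real (card \<Omega>) * ?\<epsilon>\<^sup>2 \<le>
      4096 * real n * (1 / 64 * \<alpha> * \<sigma> * sqrt (r * real (max d1 d2) / real n))\<^sup>2"
    unfolding n using pos by (intro mult_left_mono power_mono) auto
  also have "\<dots> = \<alpha>\<^sup>2 * \<sigma>\<^sup>2 * (real n * (r * real (max d1 d2) / real n))"
    using r by (simp add: power_mult_distrib power_divide)
  \<comment> \<open>Only an inequality: for \<open>n = 0\<close> the quotient is 0 by
    convention.\<close>
  also have "\<dots> \<le> \<alpha>\<^sup>2 * \<sigma>\<^sup>2 * r * real (max d1 d2)"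
    using r by (cases "n = 0") (auto simp: mult_ac)
  finally have noise: "4096 * real (card \<Omega>) * ?\<epsilon>\<^sup>2 \<le> \<alpha>\<^sup>2 * \<sigma>\<^sup>2 * r * real (max d1 d2)" .
  show "\<exists>M \<in> K_set d1 d2 \<alpha> r.
      \<P>((Z, s) in gaussian_noise d1 d2 \<sigma> \<Otimes>\<^sub>M S.
        1 / (real d1 * real d2) * (frobenius_norm (M - Mhat (observe \<Omega> M Z) s))\<^sup>2 \<ge> ?\<epsilon>) \<ge> 3 / 4"
    by (rule minimax_lower_bound[OF d \<alpha> r \<sigma> \<Omega> S alg pos _ gap noise]) simp
qed auto

end
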